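(* Let $n$ be a positive integer such that $2n+1 \neq 3^u$ for every integer $u\geq 2$. Let $\phi(x)\in \mathbb{Z}[x]$ be a monic polynomial which is irreducible modulo every prime less than $2n+2$. Let $a_n\in\mathbb{Z}$ and suppose that $a_0(x), \dots, a_{n-1}(x)\in \mathbb{Z}[x]$ satisfy: (i) $\deg a_i(x) < \deg \phi(x)$ for $0\leq i\leq n-1$; (ii) the content of the polynomial $a_n a_0(x)$ is not divisible by any prime less than $2n+2$. Then the polynomial $$f_2(x)= \frac{a_{n}}{u_{2n+2}}\phi(x)^{2n}+\sum_{j=0}^{n-1}a_j(x)\frac{\phi(x)^{2j}}{u_{2j+2}}$$ is irreducible over $\mathbb{Q}$.
   Context: For each non-negative integer $j$, $u_j$ denotes the product of the odd positive integers $\leq j$ (so $u_0=u_2=1$, $u_4=3$, $u_6=15$, ...). A polynomial in $\mathbb{Z}[x]$ is irreducible modulo a prime $p$ if its reduction modulo $p$ is irreducible in $(\mathbb{Z}/p\mathbb{Z})[x]$. The content of a polynomial in $\mathbb{Z}[x]$ is the greatest common divisor of its coefficients. *)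

theory Defs
  imports "Berlekamp_Zassenhaus.Poly_Mod"
begin

definition oddfact :: "nat \<Rightarrow> nat" where
  "oddfact j = (\<Prod>i\<in>{i\<in>{1..j}. odd i}. i)"

definition irreducible_mod :: "int \<Rightarrow> int poly \<Rightarrow> bool" where
  "irreducible_mod p f = poly_mod.irreducible_m p f"

end

(*
  Clear denominators and suppose that the resulting integral polynomial F factors as G H. A prime
  dividing 2n + 1 shows that deg G = k deg phi and deg H = (2n - k) deg phi, and we may take k <= n.
  By Schur's theorem on products of consecutive odd numbers there is a prime p >= k + 2 dividing one of
  the largest k div 2 (or, for k = 1, the largest) factors of u_(2n+2). All slopes of the
  phi-Newton polygon of F at p are at most 1/(p - 1) < 1/k, because (p - 1) v_p(u_(2j+2)) <= 2j, and
  hence phi does not divide G modulo p. But F is divisible modulo p by a power of phi whose degree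
  exceeds that of H.

  Schur's theorem is obtained by Erdos's method for the theorem of Sylvester and Schur. If a run of l
  odd numbers > 2l + 1 has only prime factors <= 2l + 1, then removing one number for each such prime
  leaves a divisor of (l - 1)!. For numbers of size at least l^2, and for l <= 1030, this contradicts
  bounds on the number of primes; in the remaining range one compares the whole run with products of
  primes, using that the product of the primes up to x is at most 4^x.
*)

theory Submission
  imports Defs
    "Berlekamp_Zassenhaus.Factor_Bound"
    "HOL-Analysis.Harmonic_Numbers"
begin

hide_const (open) Module.smult up_ring.coeff up_ring.monom comm_monoid_mult_class.coprime

section \<open>Primorials and factorials\<close>

text \<open>The exclusion of powers of 3 comes from \<open>k = 2\<close> and \<open>k = 3\<close>,
  where the run is the single number 2n + 1 and a prime \<ge> 5 is needed. Exponents u < 2 are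
  harmless: 2n + 1 = 3 forces n = 1 and \<open>k = 1\<close>, where the prime 3 suffices. Newton
  polygons are replaced by integer weights: p counts p - 1 and \<phi> counts 1, so that slopes of at
  most 1/(p - 1) become the statement that no term is lighter than (p - 1) v_p(u_(2n+2)). Condition
  (ii) ensures that the constant coefficient has exactly this weight. In the removal argument the
  odd part of the factorial suffices, because only odd primes occur; this gains a factor of about
  2^l. The computation stops at 1030 because from there on elementary counting bounds the number of
  odd primes up to 2l + 1 by l/2, and the square root of l, then at least 32, is large enough for
  the logarithmic inequalities.\<close>

definition primorial :: "nat \<Rightarrow> nat" where
  "primorial n = \<Prod>{p. prime p \<and> p \<le> n}"

lemma finite_primes_le: "finite {p::nat. prime p \<and> p \<le> n}"
  by (rule finite_subset[of _ "{..n}"]) auto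

lemma prod_primes_dvd:
  fixes m :: nat
  assumes "finite S" "\<And>p. p \<in> S \<Longrightarrow> prime p \<and> p dvd m"
  shows "\<Prod>S dvd m"
  using assms
proof (induction S rule: finite_induct)
  case (insert p S)
  have "coprime p (\<Prod>S)"
    using insert by (intro prod_coprime_right) (metis insertCI primes_coprime)
  then show ?case using insert by (simp add: divides_mult)
qed simp

lemma central_binomial_odd_le: "(2 * m + 1 choose m) \<le> 4 ^ m"
proof -
  have "2 * (2 * m + 1 choose m) = (\<Sum>k\<in>{m, m + 1}. 2 * m + 1 choose k)"
    using binomial_symmetric[of m "2 * m + 1"] by simp
  also have "\<dots> \<le> (\<Sum>k\<le>2 * m + 1. 2 * m + 1 choose k)"
    by (rule sum_mono2) auto
  also have "\<dots> = 2 * 4 ^ m" by (simp only: choose_row_sum) (simp add: power_mult)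
  finally show ?thesis by simp
qed

text \<open>Primes in the upper half, from \<open>m + 2\<close> to \<open>2 * m + 1\<close>, divide
  only the numerator of the binomial coefficient and hence the coefficient itself; the lower half is
  left to the induction.\<close>

lemma primorial_le: "primorial n \<le> 4 ^ n"
proof (induction n rule: less_induct)
  case (less n)
  show ?case
  proof (cases "n \<le> 2")
    case True
    have "{p::nat. prime p \<and> p \<le> n} = (if n = 2 then {2} else {})"
      using True by (auto simp: le_less dest: prime_ge_2_nat)
    then show ?thesis by (auto simp: primorial_def)
  next
    case n: False
    show ?thesis
    proof (cases "even n")
      case True
      have "\<not> prime n" using n True prime_odd_nat[of n] by auto
      then have "{p::nat. prime p \<and> p \<le> n} = {p. prime p \<and> p \<le> n - 1}"
        using n by (auto simp: le_diff_conv2) (metis Suc_leI le_neq_implies_less)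
      then have "primorial n = primorial (n - 1)" by (simp add: primorial_def)
      also have "\<dots> \<le> 4 ^ (n - 1)" using n less by simp
      also have "\<dots> \<le> 4 ^ n" by (intro power_increasing) auto
      finally show ?thesis .
    next
      case False
      then obtain m where m: "n = 2 * m + 1" by (elim oddE)
      define A B where "A = {p::nat. prime p \<and> p \<le> m + 1}" and "B = {p::nat. prime p \<and> m + 1 < p \<and> p \<le> n}"
      have fin: "finite A" "finite B" using finite_primes_le
        by (auto simp: A_def B_def intro: finite_subset[OF _ finite_primes_le[of n]])
      have "{p. prime p \<and> p \<le> n} = A \<union> B" "A \<inter> B = {}" using n m by (auto simp: A_def B_def)
      then have *: "primorial n = primorial (m + 1) * \<Prod>B"
        using fin by (simp add: primorial_def prod.union_disjoint A_def)
      have "\<Prod>B dvd (n choose m)"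
      proof (rule prod_primes_dvd[OF fin(2)])
        fix p assume p: "p \<in> B"
        have "p dvd fact n" using p by (auto simp: B_def intro: dvd_fact prime_gt_0_nat Suc_leI)
        also have "fact n = fact m * fact (m + 1) * (n choose m)"
          using binomial_fact_lemma[of m n] m by simp
        finally show "prime p \<and> p dvd (n choose m)"
          using p by (auto simp: B_def prime_dvd_mult_iff prime_dvd_fact_iff simp del: fact_Suc)
      qed
      then have "\<Prod>B \<le> 4 ^ m"
        using central_binomial_odd_le[of m] m by (auto dest!: dvd_imp_le intro: order_trans)
      then have "primorial n \<le> 4 ^ (m + 1) * 4 ^ m"
        unfolding * using less[of "m + 1"] n m by (intro mult_mono) auto
      also have "\<dots> = 4 ^ n" by (simp add: m power_add mult_2)
      finally show ?thesis .
    qed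
  qed
qed

lemma fact_double: "\<exists>C. fact (2 * q) = 2 ^ q * fact q * C \<and> odd (C::nat)"
proof (induction q)
  case (Suc q)
  then obtain C :: nat where C: "fact (2 * q) = 2 ^ q * fact q * C" "odd C" by blast
  have "fact (2 * Suc q) = (2 ^ Suc q * fact (Suc q) * (C * (2 * q + 1)) :: nat)"
    using C(1) by (simp add: algebra_simps)
  moreover have "odd (C * (2 * q + 1))" using C(2) by simp
  ultimately show ?case by blast
qed (auto intro: exI[of _ 1])

text \<open>By Legendre the exponent of 2 in m! is m minus the number s of binary ones of m, and a
  number with s ones is at least 2^s - 1. The induction halves \<open>m\<close> instead of counting
  digits.\<close>

lemma fact_odd_part:
  "\<exists>e (B::nat). fact m = 2 ^ e * B \<and> odd B \<and> 2 ^ m \<le> 2 ^ e * (m + 1)"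
proof (induction m rule: less_induct)
  case (less m)
  show ?case
  proof (cases "m = 0")
    case True
    then show ?thesis by (auto intro: exI[of _ 0])
  next
    case False
    define q where "q = m div 2"
    obtain e and B :: nat where eB: "fact q = 2 ^ e * B" "odd B" "2 ^ q \<le> 2 ^ e * (q + 1)"
      using less[of q] False by (auto simp: q_def)
    obtain C :: nat where C: "fact (2 * q) = 2 ^ q * fact q * C" "odd C" using fact_double by blast
    have le: "2 ^ (2 * q) \<le> 2 ^ (q + e) * (q + 1)"
      unfolding mult_2 power_add using mult_left_mono[OF eB(3), of "2 ^ q"] by (simp add: algebra_simps)
    show ?thesis
    proof (cases "even m")
      case True
      then have m: "m = 2 * q" by (simp add: q_def)
      have "2 ^ m \<le> 2 ^ (q + e) * (m + 1)" using le m by (auto intro: order_trans[OF le])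
      moreover have "fact m = 2 ^ (q + e) * (B * C)" using C(1) eB(1) m by (simp add: power_add)
      moreover have "odd (B * C)" using eB(2) C(2) by simp
      ultimately show ?thesis by blast
    next
      case False
      then have m: "m = 2 * q + 1" by (simp add: q_def)
      have "2 ^ m \<le> 2 ^ (q + e) * (m + 1)" using le m by simp
      moreover have "fact m = m * fact (2 * q)" using m by simp
      then have "fact m = 2 ^ (q + e) * (B * C * m)" unfolding C(1) eB(1) by (simp add: power_add)
      moreover have "odd (B * C * m)" using eB(2) C(2) False by simp
      ultimately show ?thesis by blast
    qed
  qed
qed

text \<open>Split at \<open>j\<close>, the product is j! (l - 1 - j)!, and the cofactor is a
  binomial coefficient.\<close>

lemma prod_dist_dvd_fact:
  fixes j l :: nat
  assumes "j < l"
  shows "(\<Prod>i\<in>{..<l} - {j}. if i < j then j - i else i - j) dvd fact (l - 1)"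
proof -
  have eq: "{..<l} - {j} = {0..<j} \<union> {j<..<l}" using assms by auto
  have "(\<Prod>i\<in>{..<l} - {j}. if i < j then j - i else i - j)
    = (\<Prod>i\<in>{0..<j}. if i < j then j - i else i - j) * (\<Prod>i\<in>{j<..<l}. if i < j then j - i else i - j)"
    unfolding eq by (intro prod.union_disjoint) auto
  also have "(\<Prod>i\<in>{0..<j}. if i < j then j - i else i - j) = (\<Prod>i\<in>{0..<j}. j - i)"
    by (rule prod.cong) auto
  also have "\<dots> = fact j" using fact_prod_rev[of j, where ?'a = nat] by simp
  also have "(\<Prod>i\<in>{j<..<l}. if i < j then j - i else i - j) = (\<Prod>i\<in>{1..l - 1 - j}. i)"
    by (rule prod.reindex_bij_witness[of _ "\<lambda>i. i + j" "\<lambda>i. i - j"]) auto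
  also have "\<dots> = fact (l - 1 - j)" by (simp add: fact_prod)
  also have "fact j * fact (l - 1 - j) dvd (fact (j + (l - 1 - j)) :: nat)"
    by (rule fact_fact_dvd_fact)
  also have "j + (l - 1 - j) = l - 1" using assms by simp
  finally show ?thesis .
qed

text \<open>At a position \<open>j\<close> of maximal multiplicity, \<open>p ^ v i\<close> divides
  both \<open>M + 2 * i\<close> and \<open>M + 2 * j\<close>, hence twice the distance of the
  positions; since \<open>p\<close> is odd, it divides the distance itself.\<close>

lemma multiplicity_remove_max:
  fixes p M l :: nat
  assumes "prime p" "odd p" "l > 0" "M > 0"
  obtains j where "j < l"
    "multiplicity p (\<Prod>i\<in>{..<l} - {j}. M + 2 * i) \<le> multiplicity p (fact (l - 1))"
proof -
  define v where "v i = multiplicity p (M + 2 * i)" for i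
  have "Max (v ` {..<l}) \<in> v ` {..<l}" using assms by (intro Max_in) auto
  then obtain j where j: "j < l" "v j = Max (v ` {..<l})" by auto
  have vle: "v i \<le> v j" if "i < l" for i using that j by simp
  define D where "D i = (if i < j then j - i else i - j)" for i
  have "v i \<le> multiplicity p (D i)" if i: "i \<in> {..<l} - {j}" for i
  proof -
    have "p ^ v i dvd M + 2 * i" by (simp add: v_def multiplicity_dvd)
    moreover have "p ^ v i dvd M + 2 * j"
      using vle[of i] i by (metis DiffD1 lessThan_iff multiplicity_dvd' v_def)
    ultimately have "p ^ v i dvd 2 * D i"
      using dvd_diff_nat[of "p ^ v i" "M + 2 * i" "M + 2 * j"] dvd_diff_nat[of "p ^ v i" "M + 2 * j" "M + 2 * i"]
      by (auto simp: D_def algebra_simps split: if_splits)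
    moreover have "coprime (p ^ v i) 2" using assms by (simp add: coprime_commute)
    ultimately have "p ^ v i dvd D i" by (simp add: coprime_dvd_mult_right_iff)
    then show ?thesis using i assms(1) by (intro multiplicity_geI) (auto simp: D_def prime_gt_Suc_0_nat dest: not_prime_unit)
  qed
  then have "(\<Sum>i\<in>{..<l} - {j}. v i) \<le> (\<Sum>i\<in>{..<l} - {j}. multiplicity p (D i))" by (rule sum_mono)
  also have "\<dots> = multiplicity p (\<Prod>i\<in>{..<l} - {j}. D i)"
    using assms(1) by (intro prime_elem_multiplicity_prod_distrib[symmetric]) (auto simp: D_def image_iff)
  also have "\<dots> \<le> multiplicity p (fact (l - 1))"
    using prod_dist_dvd_fact[OF j(1)] by (intro dvd_imp_multiplicity_le) (auto simp: D_def)
  also have "(\<Sum>i\<in>{..<l} - {j}. v i) = multiplicity p (\<Prod>i\<in>{..<l} - {j}. M + 2 * i)"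
    unfolding v_def using assms by (intro prime_elem_multiplicity_prod_distrib[symmetric]) (auto simp: image_iff)
  finally show ?thesis using that j(1) by blast
qed

section \<open>Runs of odd numbers without large prime factors\<close>

text \<open>Erdos's device: for each prime \<open>p\<close> discard one term divisible by the highest power of \<open>p\<close>. What the
  other terms contribute at \<open>p\<close> is bounded by the contribution of the differences, i.e. of a factorial.\<close>

lemma smooth_removal:
  fixes M l B e :: nat and T :: "nat set"
  assumes T: "finite T" "\<And>p. p \<in> T \<Longrightarrow> prime p \<and> odd p"
    and l: "l > 0" and M: "M > 0"
    and smooth: "\<And>i p. i < l \<Longrightarrow> prime p \<Longrightarrow> p dvd M + 2 * i \<Longrightarrow> p \<in> T"
    and B: "fact (l - 1) = 2 ^ e * B" 
  obtains j where "\<And>p. p \<in> T \<Longrightarrow> j p < l"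
    "(\<Prod>i\<in>{..<l} - j ` T. M + 2 * i) dvd B"
    "(\<Prod>i<l. M + 2 * i) dvd B * (\<Prod>p\<in>T. p ^ multiplicity p (M + 2 * j p))"
proof -
  have "\<forall>p\<in>T. \<exists>j. j < l \<and> multiplicity p (\<Prod>i\<in>{..<l} - {j}. M + 2 * i) \<le> multiplicity p (fact (l - 1))"
    using multiplicity_remove_max[OF _ _ l M] T(2) by metis
  then obtain j where j: "\<And>p. p \<in> T \<Longrightarrow> j p < l"
     "\<And>p. p \<in> T \<Longrightarrow> multiplicity p (\<Prod>i\<in>{..<l} - {j p}. M + 2 * i) \<le> multiplicity p (fact (l - 1))"
    by metis
  have B0: "B > 0" using B by (cases "B = 0") auto
  have nz: "(\<Prod>i\<in>X. M + 2 * i) \<noteq> 0" if "X \<subseteq> {..<l}" for X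
    using M finite_subset[OF that] by auto
  have fB: "multiplicity p (fact (l - 1)) = multiplicity p B" if "p \<in> T" for p
  proof -
    have "prime p" "\<not> p dvd 2 ^ e" using T(2)[OF that] prime_dvd_power[of p 2 e]
        primes_dvd_imp_eq[of p 2] by auto
    then show ?thesis unfolding B using B0
      by (subst prime_elem_multiplicity_mult_distrib) (auto simp: not_dvd_imp_multiplicity_0)
  qed
  have out: "multiplicity p (\<Prod>i\<in>X. M + 2 * i) = 0" if "X \<subseteq> {..<l}" "prime p" "p \<notin> T" for p X
  proof (rule not_dvd_imp_multiplicity_0)
    show "\<not> p dvd (\<Prod>i\<in>X. M + 2 * i)"
      using that smooth finite_subset[OF that(1)] by (subst prime_dvd_prod_iff) auto
  qed
  have "(\<Prod>i\<in>{..<l} - j ` T. M + 2 * i) dvd B"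
  proof (rule multiplicity_le_imp_dvd)
    fix p :: nat assume p: "prime p"
    show "multiplicity p (\<Prod>i\<in>{..<l} - j ` T. M + 2 * i) \<le> multiplicity p B"
    proof (cases "p \<in> T")
      case True
      have "multiplicity p (\<Prod>i\<in>{..<l} - j ` T. M + 2 * i) \<le> multiplicity p (\<Prod>i\<in>{..<l} - {j p}. M + 2 * i)"
        using True by (intro dvd_imp_multiplicity_le prod_dvd_prod_subset nz) auto
      then show ?thesis using j(2)[OF True] fB[OF True] by simp
    qed (use out p in auto)
  qed (use nz M in auto)
  \<comment> \<open>Putting back, for each \<open>p\<close>, the \<open>p\<close>-part of its
    discarded term accounts for all multiplicities. This version keeps the whole run and serves
    where the terms are small.\<close>
  moreover have "(\<Prod>i<l. M + 2 * i) dvd B * (\<Prod>p\<in>T. p ^ multiplicity p (M + 2 * j p))" (is "_ dvd B * ?R")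
  proof (rule multiplicity_le_imp_dvd)
    fix p :: nat assume p: "prime p"
    have R0: "?R \<noteq> 0" using T by (auto dest: prime_gt_0_nat)
    show "multiplicity p (\<Prod>i<l. M + 2 * i) \<le> multiplicity p (B * ?R)"
    proof (cases "p \<in> T")
      case True
      have "(\<Prod>i<l. M + 2 * i) = (M + 2 * j p) * (\<Prod>i\<in>{..<l} - {j p}. M + 2 * i)"
        using j(1)[OF True] by (intro prod.remove) auto
      then have "multiplicity p (\<Prod>i<l. M + 2 * i)
          = multiplicity p (M + 2 * j p) + multiplicity p (\<Prod>i\<in>{..<l} - {j p}. M + 2 * i)"
        using p M by (simp only:) (subst prime_elem_multiplicity_mult_distrib, auto)
      also have "\<dots> \<le> multiplicity p (M + 2 * j p) + multiplicity p B"
        using j(2)[OF True] fB[OF True] by simp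
      also have "multiplicity p (M + 2 * j p) \<le> multiplicity p ?R"
        using True T(1) p R0 by (intro multiplicity_geI dvd_prodI) (auto dest: not_prime_unit)
      finally show ?thesis using p B0 R0
        by (subst prime_elem_multiplicity_mult_distrib) auto
    qed (use out p in auto)
  qed (use nz M in auto)
  ultimately show ?thesis using that j(1) by blast
qed

lemma prod_ge_initial:
  fixes f :: "nat \<Rightarrow> nat"
  assumes "mono f" "finite X" "card X \<ge> d" "\<And>x. f x > 0"
  shows "(\<Prod>i<d. f i) \<le> prod f X"
  using assms(2,3)
proof (induction d arbitrary: X)
  case 0
  then show ?case using assms(4) by (simp add: Suc_leI prod_pos)
next
  case (Suc d)
  define m where "m = Max X"
  have ne: "X \<noteq> {}" using Suc.prems(2) by auto
  have m: "m \<in> X" unfolding m_def using ne Suc.prems(1) by (rule Max_in[rotated])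
  have "X \<subseteq> {..m}" using Suc.prems(1) by (auto simp: m_def)
  then have "card X \<le> card {..m}" by (intro card_mono) auto
  then have "d \<le> m" using Suc by simp
  have "(\<Prod>i<d. f i) \<le> prod f (X - {m})" using Suc.prems m by (intro Suc.IH) simp_all
  moreover have "f d \<le> f m" using \<open>d \<le> m\<close> assms(1) by (simp add: monoD)
  ultimately have "(\<Prod>i<d. f i) * f d \<le> prod f (X - {m}) * f m" by (rule mult_mono) auto
  also have "\<dots> = prod f X" using m Suc.prems(1) by (simp add: prod.remove[of X m f] mult.commute)
  finally show ?case by (simp add: mult.commute)
qed

text \<open>At most \<open>card T\<close> terms are discarded; whichever they are, the first
  \<open>d\<close> terms of the run bound the remaining product from below.\<close>

lemma smooth_prod_initial_le:
  fixes M l B e :: nat and T :: "nat set"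
  assumes T: "finite T" "\<And>p. p \<in> T \<Longrightarrow> prime p \<and> odd p"
    and l: "l > 0" and M: "M > 0"
    and smooth: "\<And>i p. i < l \<Longrightarrow> prime p \<Longrightarrow> p dvd M + 2 * i \<Longrightarrow> p \<in> T"
    and B: "fact (l - 1) = 2 ^ e * B" and d: "card T + d \<le> l"
  shows "(\<Prod>i<d. M + 2 * i) \<le> B"
proof -
  obtain j where j: "(\<Prod>i\<in>{..<l} - j ` T. M + 2 * i) dvd B"
    by (rule smooth_removal[OF T l M smooth B]) auto
  have "card (j ` T) \<le> card T" using T(1) by (rule card_image_le)
  then have "d \<le> card ({..<l} - j ` T)" using d diff_card_le_card_Diff[of "j ` T" "{..<l}"] T(1) by simp
  then have "(\<Prod>i<d. M + 2 * i) \<le> (\<Prod>i\<in>{..<l} - j ` T. M + 2 * i)"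
    using M by (intro prod_ge_initial monoI) simp_all
  also have "\<dots> \<le> B" using j B by (intro dvd_imp_le) (auto intro: ccontr)
  finally show ?thesis .
qed

section \<open>Numerical verification for run lengths below 1031\<close>

fun odd_part :: "int \<Rightarrow> int" where
  "odd_part x = (if x > 0 \<and> even x then odd_part (x div 2) else x)"

declare odd_part.simps [simp del]

text \<open>The numbers tested below are odd and at most 2063 < 47^2, so trial division by the odd
  primes up to 43 decides primality. The clause \<open>x = d\<close> lets the listed primes pass;
  soundness rests on every prime passing.\<close>

primrec no_small_divisor :: "int list \<Rightarrow> int \<Rightarrow> bool" where
  "no_small_divisor [] x = True"
| "no_small_divisor (d # ds) x = (if x mod d = 0 then x = d else no_small_divisor ds x)"

text \<open>For \<open>7 \<le> l < 1031\<close> the iteration below compares the odd part \<open>B\<close> of \<open>(l - 1)!\<close> with the product \<open>A\<close>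
  of the \<open>d\<close> smallest odd numbers exceeding \<open>2 l + 1\<close>, where \<open>l - d\<close> bounds the number of odd primes up
  to \<open>2 l + 1\<close>. The number \<open>q \<sqdot> 10\<^sup>6\<^sup>e\<close> is a lower bound of \<open>1000 A / B\<close>; the exponent \<open>e\<close> only keeps the
  mantissa \<open>q\<close> short. At \<open>l = 56\<close> the comparison fails by a small factor. The values at
  \<open>l = 511\<close> and \<open>l = 1030\<close> record numbers of primes.\<close>

definition ratio_step :: "(int \<times> int \<times> int \<times> nat) option \<Rightarrow> (int \<times> int \<times> int \<times> nat) option" where
  "ratio_step S = (case S of None \<Rightarrow> None | Some (l, d, q, e) \<Rightarrow>
    if (q > 1000 \<or> q > 0 \<and> e > 0 \<or> q > 700 \<and> l = 56) \<and> (l = 56 \<longrightarrow> d = 27) \<and> (l = 511 \<longrightarrow> d = 340) \<and>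
      (l = 1030 \<longrightarrow> d = 721)
    then let p = 2 * l + 3; s = no_small_divisor [3, 5, 7, 11, 13, 17, 19, 23, 29, 31, 37, 41, 43] p;
       x = q * (p + 2 * d); y = (if s then x else x * (p + 2 * d + 2));
       d' = (if s then d else d + 1); z = y div (p * odd_part l)
     in if z \<ge> 1000000000 then Some (l + 1, d', z div 1000000, Suc e)
        else if e > 0 \<and> z < 1000 then Some (l + 1, d', z * 1000000, e - 1)
        else Some (l + 1, d', z, e)
    else None)"

definition ratio_check :: "nat \<Rightarrow> int \<Rightarrow> int \<Rightarrow> int \<Rightarrow> nat \<Rightarrow> bool" where
  "ratio_check n l d q e \<longleftrightarrow> (ratio_step ^^ n) (Some (l, d, q, e)) \<noteq> None"

lemma ratio_check_Suc:
  "ratio_check (Suc n) l d q e \<longleftrightarrow>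
    (q > 1000 \<or> q > 0 \<and> e > 0 \<or> q > 700 \<and> l = 56) \<and> (l = 56 \<longrightarrow> d = 27) \<and> (l = 511 \<longrightarrow> d = 340) \<and>
    (l = 1030 \<longrightarrow> d = 721) \<and>
    (let p = 2 * l + 3; s = no_small_divisor [3, 5, 7, 11, 13, 17, 19, 23, 29, 31, 37, 41, 43] p;
       x = q * (p + 2 * d); y = (if s then x else x * (p + 2 * d + 2));
       d' = (if s then d else d + 1); z = y div (p * odd_part l)
     in if z \<ge> 1000000000 then ratio_check n (l + 1) d' (z div 1000000) (Suc e)
        else if e > 0 \<and> z < 1000 then ratio_check n (l + 1) d' (z * 1000000) (e - 1)
        else ratio_check n (l + 1) d' z e)"
proof -
  have none: "(ratio_step ^^ n) None = None"
    by (induction n) (simp_all add: ratio_step_def)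
  define p s x y d' z where "p = 2 * l + 3"
    and "s = no_small_divisor [3, 5, 7, 11, 13, 17, 19, 23, 29, 31, 37, 41, 43] p"
    and "x = q * (p + 2 * d)" and "y = (if s then x else x * (p + 2 * d + 2))"
    and "d' = (if s then d else d + 1)" and "z = y div (p * odd_part l)"
  note defs = z_def y_def x_def d'_def s_def p_def
  define C where "C \<longleftrightarrow> (q > 1000 \<or> q > 0 \<and> e > 0 \<or> q > 700 \<and> l = 56) \<and> (l = 56 \<longrightarrow> d = 27) \<and>
    (l = 511 \<longrightarrow> d = 340) \<and> (l = 1030 \<longrightarrow> d = 721)"
  have "ratio_step (Some (l, d, q, e)) = (if C then
      if z \<ge> 1000000000 then Some (l + 1, d', z div 1000000, Suc e)
      else if e > 0 \<and> z < 1000 then Some (l + 1, d', z * 1000000, e - 1) else Some (l + 1, d', z, e) else None)"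
    unfolding ratio_step_def option.case prod.case Let_def C_def defs by (rule refl)
  then have "ratio_check (Suc n) l d q e \<longleftrightarrow> C \<and>
      (if z \<ge> 1000000000 then ratio_check n (l + 1) d' (z div 1000000) (Suc e)
       else if e > 0 \<and> z < 1000 then ratio_check n (l + 1) d' (z * 1000000) (e - 1)
       else ratio_check n (l + 1) d' z e)"
    unfolding ratio_check_def funpow_Suc_right o_apply by (simp add: none)
  then show ?thesis unfolding Let_def C_def defs conj_assoc .
qed

definition twice :: "('a \<Rightarrow> 'a) \<Rightarrow> 'a \<Rightarrow> 'a" where
  "twice f x = f (f x)"

lemma twice_funpow: "twice (f ^^ n) = f ^^ (n + n)"
  by (simp add: twice_def fun_eq_iff funpow_add)

text \<open>Nested doubling in place of a numeral exponent keeps the terms small during evaluation.\<close>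

lemma ratio_check_compute:
  "twice (twice (twice (twice (twice (twice (twice (twice (twice (twice ratio_step)))))))))
    (Some (7, 2, 7177, 0)) \<noteq> None"
  by code_simp

lemma ratio_check_true: "ratio_check 1024 7 2 7177 0"
proof -
  have "twice (twice (twice (twice (twice (twice (twice (twice (twice (twice (ratio_step ^^ 1)))))))))) = ratio_step ^^ 1024"
    by (simp only: twice_funpow one_add_one numeral_plus_numeral add_num_simps)
  moreover have "ratio_step ^^ 1 = ratio_step" by simp
  ultimately show ?thesis using ratio_check_compute by (simp only: ratio_check_def not_False_eq_True)
qed

lemma no_small_divisor_prime: "prime x \<Longrightarrow> \<forall>d\<in>set ds. 1 < d \<Longrightarrow> no_small_divisor ds x"
proof (induction ds)
  case (Cons d ds)
  show ?case
  proof (cases "d dvd x")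
    case True
    then have "d = x" using Cons.prems unfolding prime_int_iff by (auto dest!: spec[of _ d])
    then show ?thesis by simp
  qed (use Cons in \<open>auto simp: dvd_eq_mod_eq_0\<close>)
qed simp

definition oddprimes :: "nat \<Rightarrow> nat set" where
  "oddprimes x = {p. prime p \<and> odd p \<and> p \<le> x}"

definition oddfac :: "nat \<Rightarrow> nat" where
  "oddfac l = (\<Prod>i\<in>{1..<l}. nat (odd_part (int i)))"

definition oddrun :: "nat \<Rightarrow> nat \<Rightarrow> nat" where
  "oddrun l d = (\<Prod>i<d. 2 * l + 3 + 2 * i)"

lemma finite_oddprimes: "finite (oddprimes x)"
  by (rule finite_subset[OF _ finite_primes_le[of x]]) (auto simp: oddprimes_def)

lemma odd_part_pos: "x > 0 \<Longrightarrow> odd_part x > 0"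
  by (induction x rule: odd_part.induct) (subst odd_part.simps, auto)

lemma odd_part_mult: "x > 0 \<Longrightarrow> \<exists>e. x = 2 ^ e * odd_part x"
proof (induction x rule: odd_part.induct)
  case (1 x)
  show ?case
  proof (cases "even x")
    case True
    then have "x div 2 > 0" using 1 by presburger
    then obtain e where "x div 2 = 2 ^ e * odd_part (x div 2)" using 1 True by metis
    moreover have "odd_part x = odd_part (x div 2)" using 1 True by (subst odd_part.simps) auto
    ultimately have "x = 2 ^ Suc e * odd_part x" using True by auto
    then show ?thesis by blast
  qed (auto intro!: exI[of _ 0] simp: odd_part.simps[of x])
qed

lemma fact_oddfac: "\<exists>e. fact (l - 1) = 2 ^ e * oddfac l"
proof (induction l)
  case (Suc l)
  show ?case
  proof (cases "l = 0")
    case False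
    obtain e where e: "fact (l - 1) = 2 ^ e * oddfac l" using Suc by blast
    obtain k where k: "int l = 2 ^ k * odd_part (int l)" using False odd_part_mult[of "int l"] by auto
    have "int (fact l) = int l * int (fact (l - 1))" using False by (simp add: fact_reduce)
    also have "\<dots> = 2 ^ (e + k) * (int (oddfac l) * odd_part (int l))"
      using e k by (simp add: power_add)
    also have "int (oddfac l) * odd_part (int l) = int (oddfac (Suc l))"
      using False odd_part_pos[of "int l"] by (simp add: oddfac_def prod.atLeastLessThan_Suc)
    also have "2 ^ (e + k) * int (oddfac (Suc l)) = int (2 ^ (e + k) * oddfac (Suc l))" by simp
    finally have "fact l = 2 ^ (e + k) * oddfac (Suc l)" by (simp only: of_nat_eq_iff)
    then show ?thesis by auto
  qed (simp add: oddfac_def exI[of _ 0])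
qed (simp add: oddfac_def exI[of _ 0])

lemma oddprimes_Suc: "oddprimes (2 * Suc l + 1) \<subseteq> oddprimes (2 * l + 1) \<union> (if prime (2 * l + 3) then {2 * l + 3} else {})"
proof
  fix p assume p: "p \<in> oddprimes (2 * Suc l + 1)"
  then have "p \<le> 2 * l + 1 \<or> p = 2 * l + 2 \<or> p = 2 * l + 3" by (auto simp: oddprimes_def)
  then show "p \<in> oddprimes (2 * l + 1) \<union> (if prime (2 * l + 3) then {2 * l + 3} else {})"
    using p by (auto simp: oddprimes_def)
qed

lemma card_oddprimes_Suc:
  "card (oddprimes (2 * Suc l + 1)) \<le> card (oddprimes (2 * l + 1)) + (if prime (2 * l + 3) then 1 else 0)"
proof -
  have "card (oddprimes (2 * Suc l + 1)) \<le> card (oddprimes (2 * l + 1) \<union> (if prime (2 * l + 3) then {2 * l + 3} else {}))"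
    using oddprimes_Suc[of l] finite_oddprimes by (intro card_mono) (auto split: if_splits)
  also have "\<dots> \<le> card (oddprimes (2 * l + 1)) + (if prime (2 * l + 3) then 1 else 0)"
    by (rule order_trans[OF card_Un_le]) auto
  finally show ?thesis .
qed

text \<open>The invariant is the assumed inequality together with the bound on \<open>d\<close>.
  From \<open>l\<close> to \<open>Suc l\<close> the run loses its first factor
  \<open>2 * l + 3\<close>, gains one at the end, and gains a second one if \<open>2 * l + 3\<close>
  fails the primality test; the factorial gains \<open>odd_part l\<close>. All divisions round down,
  so the lower bound persists.\<close>

lemma ratio_check_sound:
  assumes "ratio_check n (int l) (int d) q e" "l > 0" "card (oddprimes (2 * l + 1)) + d \<le> l"
    "q * 10 ^ (6 * e) * int (oddfac l) \<le> 1000 * int (oddrun l d)" "l \<le> k" "k < l + n"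
  shows "\<exists>d. card (oddprimes (2 * k + 1)) + d \<le> k \<and> (k \<noteq> 56 \<longrightarrow> oddfac k < oddrun k d)
    \<and> (k = 56 \<longrightarrow> d = 27 \<and> 7 * oddfac k < 10 * oddrun k d) \<and> (k = 511 \<longrightarrow> d = 340) \<and> (k = 1030 \<longrightarrow> d = 721)"
  using assms
proof (induction n arbitrary: l d q e)
  case (Suc n)
  define p s x y d' z where "p = 2 * int l + 3"
    and "s = no_small_divisor [3, 5, 7, 11, 13, 17, 19, 23, 29, 31, 37, 41, 43] p"
    and "x = q * (p + 2 * int d)" and "y = (if s then x else x * (p + 2 * int d + 2))"
    and "d' = (if s then d else d + 1)" and "z = y div (p * odd_part (int l))"
  define T :: int where "T = 10 ^ (6 * e)"
  have T: "T \<ge> 1" by (simp add: T_def)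
  have *: "(q > 1000 \<or> q > 0 \<and> e > 0 \<or> q > 700 \<and> int l = 56) \<and> (int l = 56 \<longrightarrow> int d = 27) \<and>
      (int l = 511 \<longrightarrow> int d = 340) \<and> (int l = 1030 \<longrightarrow> int d = 721) \<and>
      (if z \<ge> 1000000000 then ratio_check n (int l + 1) (if s then int d else int d + 1) (z div 1000000) (Suc e)
       else if e > 0 \<and> z < 1000 then ratio_check n (int l + 1) (if s then int d else int d + 1) (z * 1000000) (e - 1)
       else ratio_check n (int l + 1) (if s then int d else int d + 1) z e)"
    using Suc.prems(1) unfolding ratio_check_Suc Let_def z_def y_def x_def s_def p_def .
  have eq: "(if s then int d else int d + 1) = int d'" "int l + 1 = int (Suc l)" by (auto simp: d'_def)
  have c: "q > 1000 \<or> q > 0 \<and> e > 0 \<or> q > 700 \<and> l = 56" "l = 56 \<longrightarrow> d = 27" "l = 511 \<longrightarrow> d = 340" "l = 1030 \<longrightarrow> d = 721"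
    using * by linarith+
  have rec: "\<exists>q' e'. ratio_check n (int (Suc l)) (int d') q' e' \<and> q' * 10 ^ (6 * e') \<le> z * T"
  proof -
    note step = *[THEN conjunct2, THEN conjunct2, THEN conjunct2, THEN conjunct2, unfolded eq]
    consider "z \<ge> 1000000000" | "z < 1000000000" "e > 0 \<and> z < 1000" | "z < 1000000000" "\<not> (e > 0 \<and> z < 1000)"
      by linarith
    then show ?thesis
    proof cases
      case 1
      have "(z div 1000000) * 1000000 * T \<le> z * T" using T by (intro mult_right_mono) linarith+
      then have "(z div 1000000) * 10 ^ (6 * Suc e) \<le> z * T" by (simp add: T_def power_add mult_ac)
      moreover have "ratio_check n (int (Suc l)) (int d') (z div 1000000) (Suc e)" using step 1 by presburger
      ultimately show ?thesis by blast
    next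
      case 2
      then have "z * 1000000 * 10 ^ (6 * (e - 1)) = z * T" by (cases e) (auto simp: T_def power_add)
      moreover have "ratio_check n (int (Suc l)) (int d') (z * 1000000) (e - 1)" using step 2 by presburger
      ultimately show ?thesis by (metis order_refl)
    next
      case 3
      then have "ratio_check n (int (Suc l)) (int d') z e" using step by presburger
      then show ?thesis unfolding T_def by blast
    qed
  qed
  have o: "odd_part (int l) > 0" using Suc.prems(2) by (intro odd_part_pos) simp
  have pos: "oddfac l > 0"
    using odd_part_pos by (auto simp: oddfac_def intro!: prod_pos)
  have p0: "p > 0" by (simp add: p_def)
  have inv: "q * T * int (oddfac l) \<le> 1000 * int (oddrun l d)" using Suc.prems(4) by (simp add: T_def)
  show ?case
  proof (cases "k = l")
    case True
    have gt: "N * int (oddfac l) < 1000 * int (oddrun l d)" if "N < q * T" for N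
      using that pos inv by (intro less_le_trans[OF _ inv] mult_strict_right_mono) auto
    have "1000 < q * T" if "l \<noteq> 56"
    proof (cases "q > 1000")
      case True
      then show ?thesis using T by (intro less_le_trans[of 1000 q "q * T"]) auto
    next
      case False
      then have q: "q \<ge> 1" and e: "e > 0" using c(1) that by auto
      have "(10::int) ^ 6 \<le> T" unfolding T_def using e by (intro power_increasing) auto
      also have "T \<le> q * T" using q T by simp
      finally show ?thesis by simp
    qed
    moreover have "700 < q * T" if "l = 56"
    proof (cases "q > 700")
      case True
      then show ?thesis using T by (intro less_le_trans[of 700 q "q * T"]) auto
    next
      case False
      then have q: "q \<ge> 1" and e: "e > 0" using c(1) that by auto
      have "(10::int) ^ 6 \<le> T" unfolding T_def using e by (intro power_increasing) auto
      also have "T \<le> q * T" using q T by simp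
      finally show ?thesis by simp
    qed
    ultimately have "l \<noteq> 56 \<Longrightarrow> oddfac l < oddrun l d" "l = 56 \<Longrightarrow> 7 * oddfac l < 10 * oddrun l d"
      using gt[of 1000] gt[of 700] by linarith+
    then show ?thesis using True c Suc.prems(3) by (intro exI[of _ d]) auto
  next
    case False
    have "s" if "prime (2 * l + 3)"
    proof -
      have "p = int (2 * l + 3)" by (simp add: p_def)
      then have "prime p" using that by (simp only: prime_nat_int_transfer)
      then show ?thesis unfolding s_def by (rule no_small_divisor_prime) auto
    qed
    then have card: "card (oddprimes (2 * Suc l + 1)) + d' \<le> Suc l"
      using card_oddprimes_Suc[of l] Suc.prems(3) by (auto simp: d'_def split: if_splits)
    have shift: "(2 * l + 3) * oddrun (Suc l) d = oddrun l d * (2 * l + 3 + 2 * d)"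
    proof -
      have "oddrun l (Suc d) = (2 * l + 3) * oddrun (Suc l) d"
        unfolding oddrun_def by (subst prod.lessThan_Suc_shift) (simp add: algebra_simps)
      then show ?thesis by (simp add: oddrun_def)
    qed
    have shift': "p * int (oddrun (Suc l) d) = int (oddrun l d) * (p + 2 * int d)"
      using arg_cong[OF shift, of int] by (simp add: p_def algebra_simps)
    have y: "y * T * int (oddfac l) \<le> 1000 * (p * int (oddrun (Suc l) d'))"
    proof -
      have "x * T * int (oddfac l) = q * T * int (oddfac l) * (p + 2 * int d)" by (simp add: x_def)
      also have "\<dots> \<le> 1000 * int (oddrun l d) * (p + 2 * int d)"
        using inv p0 by (intro mult_right_mono) auto
      also have "\<dots> = 1000 * (p * int (oddrun (Suc l) d))" unfolding shift' by simp
      finally have *: "x * T * int (oddfac l) \<le> 1000 * (p * int (oddrun (Suc l) d))" .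
      show ?thesis
      proof (cases s)
        case False
        have "y * T * int (oddfac l) = x * T * int (oddfac l) * (p + 2 * int d + 2)" using False by (simp add: y_def)
        also have "\<dots> \<le> 1000 * (p * int (oddrun (Suc l) d)) * (p + 2 * int d + 2)"
          using * p0 by (intro mult_right_mono) auto
        also have "\<dots> = 1000 * (p * int (oddrun (Suc l) d'))"
          using False by (simp add: d'_def oddrun_def p_def algebra_simps)
        finally show ?thesis .
      qed (use * in \<open>simp add: y_def d'_def\<close>)
    qed
    have zy: "z * (p * odd_part (int l)) \<le> y"
      unfolding z_def using p0 o by (metis minus_mod_eq_div_mult diff_le_eq le_add_same_cancel1 mult_pos_pos pos_mod_sign)
    obtain q' e' where rec': "ratio_check n (int (Suc l)) (int d') q' e'" "q' * 10 ^ (6 * e') \<le> z * T"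
      using rec by blast
    have "p * (q' * 10 ^ (6 * e') * int (oddfac (Suc l))) = q' * 10 ^ (6 * e') * (p * odd_part (int l) * int (oddfac l))"
      using Suc.prems(2) o by (simp add: oddfac_def prod.atLeastLessThan_Suc)
    also have "\<dots> \<le> z * T * (p * odd_part (int l) * int (oddfac l))"
      using rec'(2) p0 o by (intro mult_right_mono) auto
    also have "\<dots> = z * (p * odd_part (int l)) * (T * int (oddfac l))" by simp
    also have "\<dots> \<le> y * (T * int (oddfac l))" using zy T by (intro mult_right_mono) auto
    also have "\<dots> \<le> 1000 * (p * int (oddrun (Suc l) d'))" using y by (simp add: mult.assoc)
    finally have "q' * 10 ^ (6 * e') * int (oddfac (Suc l)) \<le> 1000 * int (oddrun (Suc l) d')"
      using p0 by (simp add: mult.left_commute)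
    then show ?thesis using Suc.prems(5,6) False by (intro Suc.IH[OF rec'(1) _ card]) simp_all
  qed
qed simp

lemma oddprimes_small:
  "oddprimes 9 \<subseteq> {3, 5, 7}" "oddprimes 11 \<subseteq> {3, 5, 7, 11}" "oddprimes 13 \<subseteq> {3, 5, 7, 11, 13}"
  "oddprimes 15 \<subseteq> {3, 5, 7, 11, 13}"
proof -
  have *: "oddprimes 15 \<subseteq> {3, 5, 7, 11, 13}"
  proof
    fix p assume "p \<in> oddprimes 15"
    then have p: "prime p" "odd p" "p \<le> 15" by (auto simp: oddprimes_def)
    then have "p \<in> set [0..<16]" by auto
    then have "p \<in> {1, 3, 5, 7, 9, 11, 13, 15}" using p(2) by (auto simp: upt_rec)
    moreover have "\<not> prime (9::nat)" "\<not> prime (15::nat)" by (auto simp: prime_nat_iff intro!: exI[of _ 3])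
    ultimately show "p \<in> {3, 5, 7, 11, 13}" using p(1) by auto
  qed
  show "oddprimes 15 \<subseteq> {3, 5, 7, 11, 13}" by fact
  have "oddprimes x \<subseteq> {3, 5, 7, 11, 13} \<inter> {..x}" if "x \<le> 15" for x
    using * that by (auto simp: oddprimes_def)
  from this[of 9] this[of 11] this[of 13]
  show "oddprimes 9 \<subseteq> {3, 5, 7}" "oddprimes 11 \<subseteq> {3, 5, 7, 11}" "oddprimes 13 \<subseteq> {3, 5, 7, 11, 13}"
    by auto
qed

lemma oddfac_less_oddrun:
  assumes "7 \<le> k" "k < 1031"
  shows "\<exists>d. card (oddprimes (2 * k + 1)) + d \<le> k \<and> (k \<noteq> 56 \<longrightarrow> oddfac k < oddrun k d)
    \<and> (k = 56 \<longrightarrow> d = 27 \<and> 7 * oddfac k < 10 * oddrun k d) \<and> (k = 511 \<longrightarrow> d = 340) \<and> (k = 1030 \<longrightarrow> d = 721)"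
proof (rule ratio_check_sound[of 1024 7 2 7177 0])
  have "card (oddprimes 15) \<le> card {3, 5, 7, 11, 13::nat}"
    using oddprimes_small by (intro card_mono) auto
  then show "card (oddprimes (2 * 7 + 1)) + 2 \<le> 7" by simp
  \<comment> \<open>45 is the odd part of 6! and 323 = 17 * 19; 7177 is 1000 * 323 / 45 rounded
    down. From 7 on, 1024 iterations reach 1030.\<close>
  have "oddfac 7 = 45" by code_simp
  moreover have "oddrun 7 2 = 323" by (simp add: oddrun_def numeral_eq_Suc)
  ultimately show "7177 * 10 ^ (6 * 0) * int (oddfac 7) \<le> 1000 * int (oddrun 7 2)" by simp
qed (use assms ratio_check_true in auto)

lemma oddrun_le_prod: "2 * l + 3 \<le> M \<Longrightarrow> oddrun l d \<le> (\<Prod>i<d. M + 2 * i)"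
  unfolding oddrun_def by (intro prod_mono) auto

lemma odd_prime_factor_in_oddprimes:
  assumes "odd M" "prime p" "p dvd M + 2 * i" "p \<le> x"
  shows "p \<in> oddprimes x"
proof -
  have "odd (M + 2 * i)" using assms(1) by simp
  then have "odd p" using assms(3) dvd_trans by blast
  then show ?thesis using assms by (simp add: oddprimes_def)
qed

text \<open>In the two cases where the plain size comparison is not enough, \<open>l = 6\<close> and \<open>l = 56\<close>, the primes
  \<open>17\<close> and \<open>127\<close> must lie below the run, which makes its terms larger.\<close>

lemma no_smooth_run_small:
  fixes M l :: nat
  assumes M: "odd M" "2 * l + 3 \<le> M" and l: "4 \<le> l" "l < 1031"
    and smooth: "\<And>i p. i < l \<Longrightarrow> prime p \<Longrightarrow> p dvd M + 2 * i \<Longrightarrow> p \<le> 2 * l + 1"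
  shows False
proof -
  have smooth': "p \<in> oddprimes (2 * l + 1)" if "i < l" "prime p" "p dvd M + 2 * i" for i p
    using odd_prime_factor_in_oddprimes[OF M(1) that(2,3)] smooth[OF that] by blast
  \<comment> \<open>The run ends at \<open>4 * l + 1\<close> or later because
    \<open>M \<ge> 2 * l + 3\<close>; starting at or below the odd number \<open>P\<close>, it would
    contain \<open>P\<close>.\<close>
  have avoid: "P < M" if "prime P" "odd P" "2 * l + 1 < P" "P \<le> 4 * l + 1" for P :: nat
  proof (rule ccontr)
    assume "\<not> P < M"
    then have "(P - M) div 2 < l" "M + 2 * ((P - M) div 2) = P" using that M by auto
    then show False using smooth[of "(P - M) div 2" P] that by auto
  qed
  obtain e where "fact (l - 1) = 2 ^ e * oddfac l" using fact_oddfac by blast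
  note init = smooth_prod_initial_le[OF finite_oddprimes _ _ _ smooth' this]
  have init: "(\<Prod>i<d. M + 2 * i) \<le> oddfac l" if "card (oddprimes (2 * l + 1)) + d \<le> l" for d
    using that M l by (intro init) (auto simp: oddprimes_def)
  have cards: "card (oddprimes 9) \<le> 3" "card (oddprimes 11) \<le> 4" "card (oddprimes 13) \<le> 5"
    using oddprimes_small(1-3)[THEN card_mono[rotated]] by simp_all
  consider "l = 4" | "l = 5" | "l = 6" | "l = 56" | "l \<ge> 7" "l \<noteq> 56" using l by linarith
  then show False
  proof cases
    case 1
    have "oddfac 4 = 3" by code_simp
    then show ?thesis using init[of 1] 1 M cards by simp
  next
    case 2
    have "oddfac 5 = 3" by code_simp
    then show ?thesis using init[of 1] 2 M cards by simp
  next
    case 3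
    have "oddfac 6 = 15" by code_simp
    moreover have "17 < M" using 3 by (intro avoid) auto
    ultimately show ?thesis using init[of 1] 3 M cards by simp
  next
    case 4
    have c: "card (oddprimes (2 * 56 + 1)) + 27 \<le> 56" "7 * oddfac 56 < 10 * oddrun 56 27"
      using oddfac_less_oddrun[of 56] by auto
    then have "(\<Prod>i<27. M + 2 * i) \<le> oddfac 56" using init[of 27] 4 by simp
    moreover note c(2)
    moreover have "127 < M" using 4 by (intro avoid) auto
    then have "129 \<le> M" using M by (cases "M = 128") auto
    then have "(\<Prod>i<27. 129 + 2 * i) \<le> (\<Prod>i<27. M + 2 * i)" by (intro prod_mono) auto
    \<comment> \<open>\<open>oddrun 56 27\<close> starts at 115. Starting at 129 gains more than the
      factor 10/7 that the comparison at 56 may lack.\<close>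
    moreover have "10 * oddrun 56 27 < 7 * (\<Prod>i<27. 129 + 2 * i)"
      by (simp add: oddrun_def lessThan_nat_numeral)
    ultimately show ?thesis by simp
  next
    case 5
    then obtain d where "card (oddprimes (2 * l + 1)) + d \<le> l" "oddfac l < oddrun l d"
      using oddfac_less_oddrun[of l] l by auto
    then show ?thesis using init[of d] oddrun_le_prod[OF M(2), of d] by simp
  qed
qed

section \<open>Counting odd primes, and runs beyond \<open>l ^ 2\<close>\<close>

lemma card_oddprimes_add_3:
  assumes "l \<ge> 1"
  shows "card (oddprimes (2 * (l + 3) + 1)) \<le> card (oddprimes (2 * l + 1)) + 2"
proof -
  have *: "\<not> prime m" if "3 dvd m" "m > 3" for m :: nat
    using that primes_dvd_imp_eq[of 3 m] by auto
  \<comment> \<open>One of three consecutive odd numbers is a multiple of 3, and here it exceeds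
    3.\<close>
  have "3 dvd 2 * l + 3 \<or> 3 dvd 2 * Suc l + 3 \<or> 3 dvd 2 * Suc (Suc l) + 3" by presburger
  then have "\<not> prime (2 * l + 3) \<or> \<not> prime (2 * Suc l + 3) \<or> \<not> prime (2 * Suc (Suc l) + 3)"
  proof -
    have "2 * l + 3 > 3" "2 * Suc l + 3 > 3" "2 * Suc (Suc l) + 3 > 3" using assms by simp_all
    then show ?thesis using * \<open>3 dvd 2 * l + 3 \<or> _\<close> by blast
  qed
  moreover have "l + 3 = Suc (Suc (Suc l))" by simp
  ultimately show ?thesis
    using card_oddprimes_Suc[of l] card_oddprimes_Suc[of "Suc l"] card_oddprimes_Suc[of "Suc (Suc l)"]
    by (simp only:) (auto split: if_splits)
qed

text \<open>The computation gives 309 = 1030 - 721 as the count at 1030. Afterwards two primes per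
  three odd numbers are allowed, and the initial reserve keeps this crude density below
  \<open>l / 2\<close> until past 2000.\<close>

lemma card_oddprimes_half_medium:
  assumes "1030 \<le> l" "l \<le> 2000"
  shows "2 * card (oddprimes (2 * l + 1)) \<le> l"
proof -
  have add: "card (oddprimes (2 * (1030 + 3 * k) + 1)) \<le> 309 + 2 * k" for k
  proof (induction k)
    case 0
    show ?case using oddfac_less_oddrun[of 1030] by auto
  next
    case (Suc k)
    then show ?case using card_oddprimes_add_3[of "1030 + 3 * k"] by (simp add: algebra_simps)
  qed
  define k where "k = (l - 1030 + 2) div 3"
  have k: "l \<le> 1030 + 3 * k" "3 * k \<le> l - 1028" using assms(1) unfolding k_def by linarith+
  have "card (oddprimes (2 * l + 1)) \<le> card (oddprimes (2 * (1030 + 3 * k) + 1))"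
    using k(1) by (intro card_mono finite_oddprimes) (auto simp: oddprimes_def)
  also have "\<dots> \<le> 309 + 2 * k" by (rule add)
  finally show ?thesis using k(2) assms by linarith
qed

text \<open>Primes beyond 1023 are at least 1024 = 4^5, so the primorial bound
  \<open>4 ^ (2 * l + 1)\<close> admits at most \<open>(2 * l + 1) / 5\<close> of them; up to 1023
  the computation gives at most 171 = 511 - 340.\<close>

lemma card_oddprimes_half_large:
  assumes "l \<ge> 2000"
  shows "2 * card (oddprimes (2 * l + 1)) \<le> l"
proof -
  define X where "X = {p. prime p \<and> 1023 < p \<and> p \<le> 2 * l + 1}"
  have fin: "finite X" using finite_primes_le[of "2 * l + 1"] by (auto simp: X_def intro: finite_subset[rotated])
  have "1024 ^ card X = (\<Prod>p\<in>X. 1024)" by simp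
  also have "\<dots> \<le> \<Prod>X" by (intro prod_mono) (auto simp: X_def)
  also have "\<dots> \<le> primorial (2 * l + 1)" unfolding primorial_def
    using finite_primes_le
    by (intro dvd_imp_le prod_dvd_prod_subset) (auto simp: X_def prime_gt_0_nat intro!: prod_pos)
  also have "\<dots> \<le> 4 ^ (2 * l + 1)" by (rule primorial_le)
  finally have "(4::nat) ^ (5 * card X) \<le> 4 ^ (2 * l + 1)" by (simp add: power_mult)
  then have "5 * card X \<le> 2 * l + 1" using power_increasing_iff[of "4::nat"] by (simp only:) 
  moreover have "card (oddprimes (2 * 511 + 1)) \<le> 171" using oddfac_less_oddrun[of 511] by auto
  moreover have "oddprimes (2 * l + 1) \<subseteq> oddprimes (2 * 511 + 1) \<union> X"
    by (auto simp: oddprimes_def X_def)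
  then have "card (oddprimes (2 * l + 1)) \<le> card (oddprimes (2 * 511 + 1) \<union> X)"
    using fin finite_oddprimes by (intro card_mono) auto
  then have "card (oddprimes (2 * l + 1)) \<le> card (oddprimes (2 * 511 + 1)) + card X"
    using card_Un_le order_trans by blast
  ultimately show ?thesis using assms by linarith
qed

text \<open>At least half of the run survives the removal, and \<open>l / 2\<close> terms of size
  \<open>l ^ 2\<close> already exceed (l - 1)!.\<close>

lemma no_smooth_run_far:
  fixes M l :: nat
  assumes M: "odd M" "l ^ 2 \<le> M" and l: "1031 \<le> l"
    and smooth: "\<And>i p. i < l \<Longrightarrow> prime p \<Longrightarrow> p dvd M + 2 * i \<Longrightarrow> p \<le> 2 * l + 1"
  shows False
proof -
  have smooth': "p \<in> oddprimes (2 * l + 1)" if "i < l" "prime p" "p dvd M + 2 * i" for i p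
    using odd_prime_factor_in_oddprimes[OF M(1) that(2,3)] smooth[OF that] by blast
  obtain e where e: "fact (l - 1) = 2 ^ e * oddfac l" using fact_oddfac by blast
  have "2 * card (oddprimes (2 * l + 1)) \<le> l"
    using card_oddprimes_half_medium[of l] card_oddprimes_half_large[of l] l by linarith
  moreover define d where "d = l - card (oddprimes (2 * l + 1))"
  ultimately have d: "card (oddprimes (2 * l + 1)) + d = l" "l \<le> 2 * d" by simp_all
  have M0: "M > 0" using M by (auto intro: ccontr)
  have "(\<Prod>i<d. M + 2 * i) \<le> oddfac l"
    using smooth_prod_initial_le[OF finite_oddprimes _ _ M0 smooth' e, where d = d] l d(1)
    by (auto simp: oddprimes_def)
  also have "oddfac l \<le> fact (l - 1)" unfolding e by simp
  also have "\<dots> \<le> (l - 1) ^ (l - 1)" by (metis fact_le_power of_nat_id)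
  also have "\<dots> < l ^ (l - 1)" using l by (intro power_strict_mono) auto
  also have "\<dots> \<le> l ^ (2 * d)" using d l by (intro power_increasing) auto
  also have "\<dots> = (\<Prod>i<d. l ^ 2)" by (simp add: power_mult)
  also have "\<dots> \<le> (\<Prod>i<d. M + 2 * i)" using M(2) by (intro prod_mono) auto
  finally show False by simp
qed

section \<open>Size estimates for runs below \<open>l ^ 2\<close>\<close>

lemma card_oddprimes_le_half: "card (oddprimes z) \<le> z div 2"
proof -
  have "oddprimes z \<subseteq> (\<lambda>k. 2 * k + 1) ` {1..z div 2}"
  proof
    fix p assume p: "p \<in> oddprimes z"
    then obtain k where k: "p = 2 * k + 1" by (auto simp: oddprimes_def elim: oddE)
    then have "k \<ge> 1" using p by (cases k) (auto simp: oddprimes_def)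
    then show "p \<in> (\<lambda>k. 2 * k + 1) ` {1..z div 2}" using p k by (auto simp: oddprimes_def)
  qed
  then have "card (oddprimes z) \<le> card ((\<lambda>k. 2 * k + 1) ` {1..z div 2})" by (intro card_mono) auto
  also have "\<dots> \<le> card {1..z div 2}" by (rule card_image_le) simp
  finally show ?thesis by simp
qed

lemma prod_primes_le_primorial:
  assumes "X \<subseteq> {p. prime p \<and> p \<le> n}"
  shows "\<Prod>X \<le> primorial n"
  unfolding primorial_def using assms finite_primes_le[of n]
  by (intro dvd_imp_le prod_dvd_prod_subset) (auto simp: prime_gt_0_nat intro!: prod_pos)

text \<open>Each discarded term enters through its \<open>p\<close>-part, which is at most
  \<open>N\<close>, at most p^2 for \<open>p\<close> above the cube root \<open>z\<close> and at
  most \<open>p\<close> above the square root \<open>y\<close>. This yields the primorials of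
  \<open>Y\<close> and \<open>y\<close> and one factor \<open>N\<close> for each odd prime up to
  \<open>z\<close>.\<close>

lemma smooth_run_upper:
  fixes M l n y z :: nat
  assumes M: "odd M" "2 * l + 3 \<le> M" and N: "N = M + 2 * (l - 1)" and l: "l > 0"
    and y: "N < (y + 1) ^ 2" and z: "N < (z + 1) ^ 3"
    and smooth: "\<And>i p. i < l \<Longrightarrow> prime p \<Longrightarrow> p dvd M + 2 * i \<Longrightarrow> p \<le> 2 * l + 1"
    and B: "fact (l - 1) = 2 ^ e * B"
  shows "(\<Prod>i<l. M + 2 * i) \<le> B * (4 ^ (min (2 * l + 1) (N div 3) + y) * N ^ (z div 2))"
proof -
  \<comment> \<open>A term divisible by \<open>p\<close> is \<open>p * c\<close> with
    \<open>c\<close> odd, and \<open>c = 1\<close> is excluded since all terms exceed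
    \<open>2 * l + 1\<close>. The resulting bound \<open>N div 3\<close> is the sharper one when
    \<open>N < 6 * l\<close>.\<close>
  define Y where "Y = min (2 * l + 1) (N div 3)"
  have smooth': "p \<in> oddprimes Y" if h: "i < l" "prime p" "p dvd M + 2 * i" for i p
  proof -
    obtain c where c: "M + 2 * i = p * c" using h(3) by (elim dvdE)
    have "p \<le> 2 * l + 1" using smooth h by blast
    have "odd c" using M(1) c by (metis dvd_triv_left even_add even_mult_iff)
    moreover have "c \<noteq> 1" using c M(2) \<open>p \<le> 2 * l + 1\<close> by auto
    ultimately have "c \<ge> 3" by (cases "c = 2") (auto simp: le_less elim!: oddE)
    then have "p * 3 \<le> M + 2 * i" using c by simp
    also have "\<dots> \<le> N" using h(1) N by simp
    finally have "p \<le> Y" using \<open>p \<le> 2 * l + 1\<close> by (simp add: Y_def)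
    then show ?thesis using odd_prime_factor_in_oddprimes[OF M(1) h(2,3)] by blast
  qed
  have M0: "M > 0" using M by simp
  obtain j where j: "\<And>p. p \<in> oddprimes Y \<Longrightarrow> j p < l"
    and dvd: "(\<Prod>i<l. M + 2 * i) dvd B * (\<Prod>p\<in>oddprimes Y. p ^ multiplicity p (M + 2 * j p))"
    by (rule smooth_removal[OF finite_oddprimes _ l M0 smooth' B]) (auto simp: oddprimes_def)
  have B0: "B > 0" using B by (cases "B = 0") auto
  have prime: "prime p" if "p \<in> oddprimes x" for p x using that by (simp add: oddprimes_def)
  define f g where "f p = (if p \<le> y then p else 1)" and "g p = (if p \<le> z then N else 1)" for p :: nat
  have bound: "p ^ multiplicity p (M + 2 * j p) \<le> p * f p * g p" if p: "p \<in> oddprimes Y" for p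
  proof -
    define m where "m = multiplicity p (M + 2 * j p)"
    have "p ^ m \<le> M + 2 * j p" using M0 by (intro dvd_imp_le) (auto simp: m_def multiplicity_dvd)
    then have le: "p ^ m \<le> N" using j[OF p] N by simp
    have p1: "p \<ge> 1" using prime[OF p] prime_gt_0_nat[of p] by simp
    have "f p \<ge> 1" using p1 by (simp add: f_def)
    have *: "m < k" if "N < x ^ k" "x \<le> p" for x k
    proof (rule ccontr)
      assume "\<not> m < k"
      then have "p ^ k \<le> p ^ m" using p1 by (intro power_increasing) auto
      moreover have "x ^ k \<le> p ^ k" using that by (intro power_mono) auto
      ultimately show False using le that by simp
    qed
    show ?thesis unfolding m_def[symmetric]
    proof (cases "p \<le> z")
      case True
      have "1 * p ^ m \<le> (p * f p) * N" using le p1 \<open>f p \<ge> 1\<close> by (intro mult_mono) auto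
      then show "p ^ m \<le> p * f p * g p" using True by (simp add: g_def)
    next
      case False
      then have "m \<le> 2" using *[OF z] by simp
      show "p ^ m \<le> p * f p * g p"
      proof (cases "p \<le> y")
        case True
        have "p ^ m \<le> p ^ 2" using \<open>m \<le> 2\<close> p1 by (intro power_increasing) auto
        then show ?thesis using True \<open>\<not> p \<le> z\<close> by (simp add: f_def g_def power2_eq_square)
      next
        case False
        then have "m \<le> 1" using *[OF y] by simp
        then have "p ^ m \<le> p ^ 1" using p1 by (intro power_increasing) auto
        then show ?thesis using False \<open>\<not> p \<le> z\<close> by (simp add: f_def g_def)
      qed
    qed
  qed
  have "(\<Prod>i<l. M + 2 * i) \<le> B * (\<Prod>p\<in>oddprimes Y. p ^ multiplicity p (M + 2 * j p))"
    using dvd B0 finite_oddprimes prime by (intro dvd_imp_le) (auto intro!: prod_pos prime_gt_0_nat)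
  also have "\<dots> \<le> B * (\<Prod>p\<in>oddprimes Y. p * f p * g p)"
    using bound by (intro mult_left_mono prod_mono) auto
  also have "(\<Prod>p\<in>oddprimes Y. p * f p * g p) = \<Prod>(oddprimes Y) * prod f (oddprimes Y) * prod g (oddprimes Y)"
    by (simp add: prod.distrib)
  also have "\<dots> \<le> 4 ^ Y * 4 ^ y * N ^ (z div 2)"
  proof (intro mult_mono)
    show "\<Prod>(oddprimes Y) \<le> 4 ^ Y"
      by (rule order_trans[OF prod_primes_le_primorial primorial_le]) (auto simp: oddprimes_def)
    have "prod f (oddprimes Y) = \<Prod>{p \<in> oddprimes Y. p \<le> y}"
      using finite_oddprimes by (subst prod.inter_filter) (auto simp: f_def)
    also have "\<dots> \<le> 4 ^ y"
      by (rule order_trans[OF prod_primes_le_primorial primorial_le]) (auto simp: oddprimes_def)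
    finally show "prod f (oddprimes Y) \<le> 4 ^ y" .
    have "prod g (oddprimes Y) = (\<Prod>p\<in>{p \<in> oddprimes Y. p \<le> z}. N)"
      using finite_oddprimes by (subst prod.inter_filter) (auto simp: g_def)
    also have "\<dots> = N ^ card {p \<in> oddprimes Y. p \<le> z}" by simp
    also have "\<dots> \<le> N ^ (z div 2)"
    proof (rule power_increasing)
      have "card {p \<in> oddprimes Y. p \<le> z} \<le> card (oddprimes z)"
        using finite_oddprimes by (intro card_mono) (auto simp: oddprimes_def)
      then show "card {p \<in> oddprimes Y. p \<le> z} \<le> z div 2" using card_oddprimes_le_half[of z] by simp
    qed (use M0 N in simp)
    finally show "prod g (oddprimes Y) \<le> N ^ (z div 2)" .
  qed auto
  finally show ?thesis using B0 by (simp add: Y_def power_add mult.assoc)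
qed

text \<open>The terms are 2(n - i) + 1, and (n - i)/n \<ge> (2l - i)/(2l) because n \<ge> 2l; this
  reduces the product to (2l)!/l! and the central binomial coefficient. The powers of 2 missing from
  \<open>B\<close> improve \<open>4 * n\<close> to \<open>8 * n\<close>; with \<open>4 * n\<close>
  the final estimate would fail around N = 6l, where log 2 12 < 4.\<close>

lemma smooth_run_lower:
  fixes M l n :: nat
  assumes l: "l > 0" and n: "2 * l \<le> n" and N: "M + 2 * l = 2 * n + 3"
    and B: "fact (l - 1) = 2 ^ e * B" "2 ^ (l - 1) \<le> 2 ^ e * l"
  shows "(8 * n) ^ l * B \<le> 4 * l * l ^ l * (\<Prod>i<l. M + 2 * i)"
proof -
  have "(\<Prod>i<l. M + 2 * i) = (\<Prod>i<l. M + 2 * (l - Suc i))"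
    by (rule prod.nat_diff_reindex[symmetric])
  then have "(\<Prod>i<l. M + 2 * i) * (2 * l) ^ l = (\<Prod>i<l. (M + 2 * (l - Suc i)) * (2 * l))"
    by (simp add: prod.distrib)
  also have "\<dots> \<ge> (\<Prod>i<l. 2 * n * (2 * l - i))"
  proof (intro prod_mono conjI)
    fix i assume i: "i \<in> {..<l}"
    have "n * (2 * l - i) \<le> (n - i) * (2 * l)"
    proof -
      have "i * (2 * l) \<le> n * i" using n by (simp add: mult.commute)
      then show ?thesis unfolding diff_mult_distrib diff_mult_distrib2 by (rule diff_le_mono2)
    qed
    moreover have "2 * (n - i) \<le> M + 2 * (l - Suc i)" using N i by auto
    then have "2 * (n - i) * (2 * l) \<le> (M + 2 * (l - Suc i)) * (2 * l)" by (rule mult_right_mono) simp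
    moreover have "2 * n * (2 * l - i) = 2 * (n * (2 * l - i))" "2 * (n - i) * (2 * l) = 2 * ((n - i) * (2 * l))"
      by simp_all
    ultimately show "2 * n * (2 * l - i) \<le> (M + 2 * (l - Suc i)) * (2 * l)" by linarith
  qed auto
  also have "(\<Prod>i<l. 2 * n * (2 * l - i)) = (2 * n) ^ l * (\<Prod>i<l. 2 * l - i)"
    by (simp only: prod.distrib prod_constant card_lessThan power_mult_distrib)
  finally have 1: "(2 * n) ^ l * (\<Prod>i<l. 2 * l - i) \<le> (\<Prod>i<l. M + 2 * i) * (2 * l) ^ l" .
  have "(\<Prod>i<l. 2 * l - i) = prod Suc {2 * l - l..<2 * l}"
    by (rule prod.reindex_bij_witness[of _ "\<lambda>k. 2 * l - 1 - k" "\<lambda>k. 2 * l - 1 - k"]) auto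
  then have "(\<Prod>i<l. 2 * l - i) * fact l = fact (2 * l)"
    using fact_split[of l "2 * l", where ?'a = nat] by simp
  also have "\<dots> = fact l * fact l * (2 * l choose l)"
    using binomial_fact_lemma[of l "2 * l"] by simp
  finally have 2: "(\<Prod>i<l. 2 * l - i) = fact l * (2 * l choose l)" by simp
  have "real (4 ^ l) \<le> real (2 * l * (2 * l choose l))"
    using central_binomial_lower_bound[OF l] l by (simp add: field_simps)
  then have 3: "4 ^ l \<le> 2 * l * (2 * l choose l)" by (simp only: of_nat_le_iff)
  have "2 ^ (l - 1) * B \<le> 2 ^ e * l * B" using B(2) by (rule mult_right_mono) simp
  also have "\<dots> = fact l" using B(1) l by (simp add: fact_reduce)
  finally have "2 * (2 ^ (l - 1) * B) \<le> 2 * fact l" by simp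
  moreover have "2 * 2 ^ (l - 1) = (2::nat) ^ l" using l by (cases l) auto
  ultimately have 4: "2 ^ l * B \<le> 2 * fact l" by (metis mult.assoc)
  have "(2 * n * 4) ^ l = (2 * n) ^ l * 4 ^ l" by (rule power_mult_distrib)
  then have "(8 * n) ^ l * B * 2 ^ l = (2 * n) ^ l * 4 ^ l * (2 ^ l * B)" by (simp add: mult.commute)
  also have "\<dots> \<le> (2 * n) ^ l * (2 * l * (2 * l choose l)) * (2 * fact l)"
    by (intro mult_mono[OF mult_left_mono[OF 3] 4]) simp_all
  also have "\<dots> = 4 * l * ((2 * n) ^ l * (\<Prod>i<l. 2 * l - i))" by (simp add: 2)
  also have "\<dots> \<le> 4 * l * ((\<Prod>i<l. M + 2 * i) * (2 * l) ^ l)" using 1 by (intro mult_left_mono) auto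
  also have "\<dots> = 4 * l * l ^ l * (\<Prod>i<l. M + 2 * i) * 2 ^ l" by (simp add: power_mult_distrib)
  finally show ?thesis by simp
qed

text \<open>This is ln t \<le> t - 1 at t = x/2^k, with 1/ln 2 rounded up to 3/2, which is allowed
  as t \<ge> 1. In each use \<open>2 ^ k\<close> is the known lower bound of
  \<open>x\<close>.\<close>

lemma log2_le_linear:
  fixes x :: real
  assumes "2 ^ k \<le> x"
  shows "log 2 x \<le> 3 / 2 * (x / 2 ^ k) - 3 / 2 + k"
proof -
  have x: "x > 0" using assms by (smt (verit) zero_less_power)
  have "log 2 (x / 2 ^ k) = ln (x / 2 ^ k) / ln 2" by (simp add: log_def)
  also have "\<dots> \<le> (x / 2 ^ k - 1) / ln 2"
    using x by (intro divide_right_mono ln_le_minus_one) auto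
  also have "\<dots> \<le> (x / 2 ^ k - 1) / (2 / 3)"
    using assms ln2_ge_two_thirds by (intro divide_left_mono) (auto simp: field_simps)
  finally have "log 2 (x / 2 ^ k) \<le> 3 / 2 * (x / 2 ^ k) - 3 / 2" by (simp add: diff_divide_distrib)
  moreover have "log 2 (x / 2 ^ k) = log 2 x - k" using x by (simp add: log_divide log_nat_power)
  ultimately show ?thesis by linarith
qed

text \<open>With \<open>x = l\<^sup>1\<^sup>/\<^sup>2\<close> and \<open>s = N\<^sup>1\<^sup>/\<^sup>6\<close>, taking logarithms to base \<open>2\<close> leaves inequalities that are
  polynomial in \<open>x\<close> in each of five ranges of \<open>N / l\<close>.\<close>

lemma growth_contradiction:
  fixes l n N y z Y :: nat
  assumes l: "1031 \<le> l" and n: "2 * l \<le> n" and N: "N = 2 * n + 1" "N < (l + 1) ^ 2"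
    and y: "y ^ 2 \<le> N" and z: "z ^ 3 \<le> N" and Y: "Y \<le> 2 * l + 1" "3 * Y \<le> N"
    and le: "(8 * n) ^ l \<le> 4 * l * l ^ l * (4 ^ (Y + y) * N ^ (z div 2))"
  shows False
proof -
  define x s where "x = sqrt (real l)" and "s = root 6 (real N)"
  have x2: "real l = x * x" by (simp add: x_def)
  have x32: "x \<ge> 32" unfolding x_def using l by (intro real_le_rsqrt) auto
  then have xx: "32 * x \<le> x * x" by (intro mult_right_mono) auto
  have s6: "s ^ 6 = real N" by (simp add: s_def)
  have s0: "s \<ge> 0" by (simp add: s_def)
  have s4: "s \<ge> 4"
  proof (rule ccontr)
    assume "\<not> s \<ge> 4"
    then have "s ^ 6 \<le> 4 ^ 6" using s0 by (intro power_mono) auto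
    then show False using s6 N n l by simp
  qed
  have ys: "real y \<le> s ^ 3"
  proof (rule power2_le_imp_le)
    have "real y ^ 2 \<le> real N" using y by (metis of_nat_le_iff semiring_1_class.of_nat_power)
    then show "real y ^ 2 \<le> (s ^ 3) ^ 2" using s6 by (simp flip: power_mult)
  qed (use s0 in simp)
  have zs: "real z \<le> s ^ 2"
  proof (rule power_le_imp_le_base)
    have "real z ^ 3 \<le> real N" using z by (metis of_nat_le_iff semiring_1_class.of_nat_power)
    then show "real z ^ Suc 2 \<le> (s ^ 2) ^ Suc 2" using s6 by (simp flip: power_mult add: eval_nat_numeral)
  qed (use s0 in simp)
  have logs: "log 2 s \<le> 3 / 8 * s + 1 / 2" using log2_le_linear[of 2 s] s4 by (simp; linarith)
  have logx: "log 2 x \<le> 3 / 64 * x + 7 / 2" using log2_le_linear[of 5 x] x32 by (simp; linarith)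
  have logN: "log 2 (real N) = 6 * log 2 s" using s4 by (simp flip: s6 add: log_nat_power)
  have logl: "log 2 (real l) = 2 * log 2 x" using x32 by (simp add: x2 log_mult)
  \<comment> \<open>7/2 = 2 + 9/8 + 3/8, the last summand from
    \<open>3 / 2 * s ^ 2 \<le> 3 / 8 * s ^ 3\<close> for \<open>s \<ge> 4\<close>.\<close>
  have E: "2 * real y + real (z div 2) * log 2 (real N) \<le> 7 / 2 * s ^ 3"
  proof -
    have "real (z div 2) \<le> s ^ 2 / 2" using zs by linarith
    moreover have "log 2 (real N) \<le> 9 / 4 * s + 3" using logN logs by simp
    moreover have "log 2 (real N) \<ge> 0" using N by simp
    ultimately have "real (z div 2) * log 2 (real N) \<le> s ^ 2 / 2 * (9 / 4 * s + 3)"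
      by (intro mult_mono) auto
    also have "\<dots> = 9 / 8 * s ^ 3 + 3 / 2 * s ^ 2" by (simp add: power2_eq_square power3_eq_cube field_simps)
    finally have "real (z div 2) * log 2 (real N) \<le> 9 / 8 * s ^ 3 + 3 / 2 * s ^ 2" .
    moreover have "s ^ 2 * 4 \<le> s ^ 2 * s" using s4 by (intro mult_left_mono) auto
    then have "4 * s ^ 2 \<le> s ^ 3" by (simp add: power2_eq_square power3_eq_cube)
    ultimately show ?thesis using ys by linarith
  qed
  have main: "x * x * log 2 (8 * n / l) \<le> 2 + 2 * log 2 x + 2 * Y + 7 / 2 * s ^ 3"
  proof -
    have pos: "real l > 0" "real n > 0" "real N > 0" using l n N by auto
    have "real ((8 * n) ^ l) \<le> real (4 * l * l ^ l * (4 ^ (Y + y) * N ^ (z div 2)))"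
      using le by (simp only: of_nat_le_iff)
    then have "log 2 (real ((8 * n) ^ l)) \<le> log 2 (real (4 * l * l ^ l * (4 ^ (Y + y) * N ^ (z div 2))))"
      using pos by (subst log_le_cancel_iff) auto
    also have "log 2 (real ((8 * n) ^ l)) = l * log 2 (8 * n)"
      unfolding semiring_1_class.of_nat_power using pos by (intro log_nat_power) simp
    also have "log 2 (real (4 * l * l ^ l * (4 ^ (Y + y) * N ^ (z div 2))))
        = log 2 4 + log 2 l + l * log 2 l + ((Y + y) * log 2 4 + (z div 2) * log 2 N)"
      using pos by (simp add: log_mult log_nat_power)
    also have "log 2 (4::real) = 2" using log_nat_power[of 2 2 2] by simp
    finally have "l * (log 2 (8 * n) - log 2 l) \<le> 2 + log 2 l + 2 * Y + (2 * y + (z div 2) * log 2 N)"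
      by (simp add: algebra_simps)
    also have "log 2 (8 * n) - log 2 l = log 2 (8 * n / l)" using pos by (simp add: log_divide)
    finally show ?thesis using E logl x2 by simp
  qed
  have lower: "c \<le> log 2 (8 * n / l)" if "2 powr c * l \<le> 8 * n" for c :: real
    using that l n by (subst le_log_iff) (auto simp: field_simps)
  have root: "s ^ 3 \<le> c * x" if "real N \<le> c ^ 2 * l" "c \<ge> 0" for c :: real
  proof (rule power2_le_imp_le)
    have "(s ^ 3) ^ 2 = real N" using s6 by (simp flip: power_mult)
    also have "\<dots> \<le> (c * x) ^ 2" using that by (simp add: x2 power2_eq_square mult_ac)
    finally show "(s ^ 3) ^ 2 \<le> (c * x) ^ 2" .
  qed (use x32 that in simp)
  \<comment> \<open>From \<open>n \<ge> 2 * l\<close> alone the logarithm is known to reach only 4,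
    no more than the coefficient in \<open>2 * Y \<le> 4 * l + 2\<close>. Up to \<open>5 * l\<close>
    the bound \<open>3 * Y \<le> N\<close> lowers that coefficient to 10/3; beyond, the logarithm
    has passed 4. The last range uses \<open>N < (l + 1) ^ 2\<close>: 4 + 7/2 < 8. The second and
    fourth set \<open>8 / 25 * x\<close> against 35/4 and \<open>x\<close> against 28, and there
    \<open>x \<ge> 32\<close> is spent.\<close>
  consider "N \<le> 5 * l" | "5 * l < N" "N \<le> 6 * l" | "6 * l < N" "N \<le> 8 * l"
    | "8 * l < N" "N \<le> 64 * l" | "64 * l < N" by linarith
  then show False
  proof cases
    case 1
    have "4 \<le> log 2 (8 * n / l)" using n by (intro lower) simp
    then have "x * x * 4 \<le> x * x * log 2 (8 * n / l)" by (intro mult_left_mono) auto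
    moreover have "s ^ 3 \<le> 56 / 25 * x" using 1 by (intro root) (auto simp: power2_eq_square)
    moreover have "2 * real Y \<le> 10 / 3 * (x * x)" using Y 1 by (simp flip: x2)
    ultimately show False using main logx x32 xx by linarith
  next
    case 2
    have "(2 powr (108 / 25)) ^ 25 \<le> (20::real) ^ 25" by (simp flip: powr_realpow add: powr_powr)
    then have "2 powr (108 / 25) \<le> (20::real)" by (rule power_mono_iff[THEN iffD1, rotated -1]) auto
    then have "2 powr (108 / 25) * real l \<le> 20 * real l" by (rule mult_right_mono) simp
    then have "108 / 25 \<le> log 2 (8 * n / l)" using 2 N by (intro lower) linarith
    then have "x * x * (108 / 25) \<le> x * x * log 2 (8 * n / l)" by (intro mult_left_mono) auto
    moreover have "s ^ 3 \<le> 5 / 2 * x" using 2 by (intro root) (auto simp: power2_eq_square)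
    moreover have "2 * real Y \<le> 4 * (x * x) + 2" using Y by (simp flip: x2)
    ultimately show False using main logx x32 xx by linarith
  next
    case 3
    have "(2 powr (9 / 2)) ^ 2 \<le> (24::real) ^ 2" by (simp flip: powr_realpow add: powr_powr)
    then have "2 powr (9 / 2) \<le> (24::real)" by (rule power_mono_iff[THEN iffD1, rotated -1]) auto
    then have "2 powr (9 / 2) * real l \<le> 24 * real l" by (rule mult_right_mono) simp
    then have "9 / 2 \<le> log 2 (8 * n / l)" using 3 N by (intro lower) linarith
    then have "x * x * (9 / 2) \<le> x * x * log 2 (8 * n / l)" by (intro mult_left_mono) auto
    moreover have "s ^ 3 \<le> 283 / 100 * x" using 3 by (intro root) (auto simp: power2_eq_square)
    moreover have "2 * real Y \<le> 4 * (x * x) + 2" using Y by (simp flip: x2)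
    ultimately show False using main logx x32 xx by linarith
  next
    case 4
    have "5 \<le> log 2 (8 * n / l)" using 4 N by (intro lower) simp
    then have "x * x * 5 \<le> x * x * log 2 (8 * n / l)" by (intro mult_left_mono) auto
    moreover have "s ^ 3 \<le> 8 * x" using 4 by (intro root) (auto simp: power2_eq_square)
    moreover have "2 * real Y \<le> 4 * (x * x) + 2" using Y by (simp flip: x2)
    ultimately show False using main logx x32 xx by linarith
  next
    case 5
    have "8 \<le> log 2 (8 * n / l)" using 5 N by (intro lower) simp
    then have "x * x * 8 \<le> x * x * log 2 (8 * n / l)" by (intro mult_left_mono) auto
    moreover have "s ^ 3 \<le> x * x + 1"
    proof (rule power2_le_imp_le)
      have "real N < real (l + 1) ^ 2" using N(2) by (metis of_nat_less_iff semiring_1_class.of_nat_power)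
      then show "(s ^ 3) ^ 2 \<le> (x * x + 1) ^ 2" using s6 by (simp flip: power_mult x2 add: add.commute)
    qed (use x32 in simp)
    moreover have "2 * real Y \<le> 4 * (x * x) + 2" using Y by (simp flip: x2)
    ultimately show False using main logx x32 xx by linarith
  qed
qed

lemma nat_root_exists:
  assumes "k > 0"
  obtains z :: nat where "z ^ k \<le> N" "N < (z + 1) ^ k"
proof -
  have "\<exists>z. z ^ k \<le> N \<and> N < (z + 1) ^ k"
  proof (induction N)
    case 0
    then show ?case using assms by (intro exI[of _ 0]) simp
  next
    case (Suc N)
    then obtain z where z: "z ^ k \<le> N" "N < (z + 1) ^ k" by blast
    show ?case
    proof (cases "Suc N < (z + 1) ^ k")
      case False
      then have "(z + 1) ^ k = Suc N" using z by simp
      moreover have "(z + 1) ^ k < (z + 2) ^ k" using assms by (intro power_strict_mono) auto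
      ultimately show ?thesis by (intro exI[of _ "z + 1"]) simp
    qed (use z in \<open>auto intro: le_SucI\<close>)
  qed
  then show ?thesis using that by blast
qed

text \<open>The odd part \<open>B\<close> of the factorial occurs in both the lower and the upper
  estimate and cancels, leaving an inequality free of factorials.\<close>

lemma no_smooth_run_near:
  fixes M l :: nat
  assumes M: "odd M" "2 * l + 3 \<le> M" "M < l ^ 2" and l: "1031 \<le> l"
    and smooth: "\<And>i p. i < l \<Longrightarrow> prime p \<Longrightarrow> p dvd M + 2 * i \<Longrightarrow> p \<le> 2 * l + 1"
  shows False
proof -
  define N n where "N = M + 2 * (l - 1)" and "n = (M + 2 * l - 3) div 2"
  have even: "even (M + 2 * l - 3)" using M l by auto
  then have n: "M + 2 * l = 2 * n + 3" "2 * l \<le> n" using M l by (auto simp: n_def)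
  have N: "N = 2 * n + 1" using n l by (simp add: N_def)
  obtain y where y: "y ^ 2 \<le> N" "N < (y + 1) ^ 2" using nat_root_exists[of 2 N] by auto
  obtain z where z: "z ^ 3 \<le> N" "N < (z + 1) ^ 3" using nat_root_exists[of 3 N] by auto
  obtain e and B :: nat where B: "fact (l - 1) = 2 ^ e * B" "odd B" "2 ^ (l - 1) \<le> 2 ^ e * (l - 1 + 1)"
    using fact_odd_part[of "l - 1"] by auto
  have B0: "B > 0" using B(2) by (cases B) auto
  define U where "U = 4 ^ (min (2 * l + 1) (N div 3) + y) * N ^ (z div 2)"
  have "(8 * n) ^ l * B \<le> 4 * l * l ^ l * (\<Prod>i<l. M + 2 * i)"
    using l n B by (intro smooth_run_lower[of l n M e]) auto
  also have "\<dots> \<le> 4 * l * l ^ l * (B * U)"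
    unfolding U_def using smooth_run_upper[OF M(1,2) N_def _ y(2) z(2) smooth B(1)] l
    by (intro mult_left_mono) auto
  finally have "(8 * n) ^ l * B \<le> (4 * l * l ^ l * U) * B" by (simp add: mult_ac)
  then have "(8 * n) ^ l \<le> 4 * l * l ^ l * U" using B0 by simp
  moreover have "N < (l + 1) ^ 2" using M(3) by (simp add: N_def power2_eq_square)
  moreover have "3 * min (2 * l + 1) (N div 3) \<le> 3 * (N div 3)" by simp
  then have "3 * min (2 * l + 1) (N div 3) \<le> N" by (rule order_trans) simp
  ultimately show False unfolding U_def
    by (intro growth_contradiction[OF l n(2) N _ y(1) z(1), of "min (2 * l + 1) (N div 3)"]) simp_all
qed

section \<open>Neighbouring prime powers and Schur's theorem\<close>

lemma only_prime_factor_power: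
  fixes n q :: nat
  assumes "n > 0" "prime q" "\<And>p. prime p \<Longrightarrow> p dvd n \<Longrightarrow> p = q"
  obtains k where "n = q ^ k"
proof -
  obtain c where c: "n = q ^ multiplicity q n * c" "\<not> q dvd c"
    using multiplicity_decompose'[of n q] assms(1,2) by (metis not_prime_unit not_gr_zero)
  have "c = 1"
  proof (rule ccontr)
    assume "c \<noteq> 1"
    then obtain p where "prime p" "p dvd c" using prime_factor_nat by blast
    then show False using assms(3)[of p] c by (metis dvd_mult)
  qed
  then show ?thesis using that c(1) by simp
qed

lemma power_mod_periodic:
  fixes b m :: nat
  assumes "b ^ d mod m = 1"
  shows "b ^ k mod m = b ^ (k mod d) mod m"
proof -
  have "b ^ k = (b ^ d) ^ (k div d) * b ^ (k mod d)"
    by (simp flip: power_mult power_add)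
  also have "\<dots> mod m = ((b ^ d mod m) ^ (k div d) mod m) * b ^ (k mod d) mod m"
    by (metis mod_mult_left_eq power_mod)
  also have "\<dots> = (1 mod m) * b ^ (k mod d) mod m" using assms by simp
  also have "\<dots> = b ^ (k mod d) mod m" by (metis mod_mult_left_eq mult_1)
  finally show ?thesis .
qed

text \<open>Working modulo \<open>9\<close>, then \<open>7\<close>, then \<open>4\<close> excludes all solutions.\<close>

lemma pow5_ne_pow3_plus_2:
  assumes "a \<ge> 2"
  shows "(5::nat) ^ b \<noteq> 3 ^ a + 2"
proof
  assume eq: "(5::nat) ^ b = 3 ^ a + 2"
  have lt6: "r = 0 \<or> r = 1 \<or> r = 2 \<or> r = 3 \<or> r = 4 \<or> r = 5" if "r < 6" for r :: nat using that by arith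
  \<comment> \<open>63 = 9 * 7 and 28 = 7 * 4. Modulo either number the powers have period 6, and
    the residue known modulo the first factor fixes the one modulo the second.\<close>
  have five: "(5::nat) ^ r mod 63 = 38" if "(5::nat) ^ r mod 63 mod 9 = 2" "r < 6" for r
    using lt6[OF that(2)] that(1) by (elim disjE) simp_all
  have three: "(3::nat) ^ r mod 28 = 1" if "(3::nat) ^ r mod 28 mod 7 = 1" "r < 6" for r
    using lt6[OF that(2)] that(1) by (elim disjE) simp_all
  have b: "(5::nat) ^ b mod 63 = 5 ^ (b mod 6) mod 63" by (rule power_mod_periodic) simp
  have a: "(3::nat) ^ a mod 28 = 3 ^ (a mod 6) mod 28" by (rule power_mod_periodic) simp
  have "(5::nat) ^ b mod 4 = 5 ^ (b mod 1) mod 4" by (rule power_mod_periodic) simp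
  then have b4: "(5::nat) ^ b mod 4 = 1" by simp
  have "(3::nat) ^ 2 dvd 3 ^ a" using assms by (rule le_imp_power_dvd)
  then have "(3::nat) ^ a mod 9 = 0" by simp
  then have "(3 ^ a + 2) mod 9 = (2::nat)" using mod_add_left_eq[of "3 ^ a" "9::nat" 2] by simp
  then have "(5::nat) ^ b mod 63 mod 9 = 2" unfolding eq by (simp add: mod_mod_cancel)
  then have "(5::nat) ^ b mod 63 = 38" unfolding b by (intro five) simp_all
  then have "(5::nat) ^ b mod 63 mod 7 = 3" by simp
  then have "(3 ^ a + 2) mod 7 = (3::nat)" unfolding eq by (simp add: mod_mod_cancel)
  then have "(3::nat) ^ a mod 7 = 1" by presburger
  then have "(3::nat) ^ a mod 28 mod 7 = 1" by (simp add: mod_mod_cancel)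
  then have "(3::nat) ^ a mod 28 = 1" unfolding a by (intro three) simp_all
  then have "(3::nat) ^ a mod 28 mod 4 = 1" by simp
  then have "(3::nat) ^ a mod 4 = 1" by (simp add: mod_mod_cancel)
  moreover have "(3 ^ a + 2) mod 4 = (1::nat)" using b4 unfolding eq .
  ultimately show False by presburger
qed

text \<open>Schur's analogue of Sylvester's theorem for odd numbers. The last term is not allowed to be a
  power of \<open>3\<close>, which also rules out the genuine exception \<open>25, 27\<close>.\<close>

lemma schur_odd_run:
  fixes M l :: nat
  assumes M: "odd M" "2 * l + 3 \<le> M" and l: "l \<ge> 1" and pow: "\<And>u. M + 2 * (l - 1) \<noteq> 3 ^ u"
  shows "\<exists>i p. i < l \<and> prime p \<and> 2 * l + 3 \<le> p \<and> p dvd M + 2 * i"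
proof (rule ccontr)
  assume contr: "\<nexists>i p. i < l \<and> prime p \<and> 2 * l + 3 \<le> p \<and> p dvd M + 2 * i"
  have odd: "odd p" if "p dvd M + 2 * i" for p i
    using M(1) that by (metis dvd_trans even_add even_mult_iff even_numeral)
  have smooth: "p \<le> 2 * l + 1" if "i < l" "prime p" "p dvd M + 2 * i" for i p
  proof -
    have "p < 2 * l + 3" using contr that by (meson not_le)
    moreover have "p \<noteq> 2 * l + 2" using odd[OF that(3)] by auto
    ultimately show ?thesis by simp
  qed
  have odd': "p \<in> oddprimes (2 * l + 1)" if "i < l" "prime p" "p dvd M + 2 * i" for i p
    using smooth[OF that] odd[OF that(3)] that(2) by (simp add: oddprimes_def)
  have sub7: "oddprimes 7 \<subseteq> {3, 5, 7}" "oddprimes 5 \<subseteq> {3, 5}" "oddprimes 3 \<subseteq> {3}"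
    using oddprimes_small(1) by (auto simp: oddprimes_def)
  have primes: "prime (3::nat)" "prime (5::nat)" "prime (7::nat)" by simp_all
  consider "l = 1" | "l = 2" | "l = 3" | "4 \<le> l" "l < 1031" | "1031 \<le> l" using l by linarith
  then show False
  proof cases
    case 1
    obtain k where "M = 3 ^ k"
    proof (rule only_prime_factor_power[of M 3])
      show "p = 3" if "prime p" "p dvd M" for p using odd'[of 0 p] that sub7 1 by auto
    qed (use M in auto)
    then show ?thesis using pow[of k] 1 by simp
  next
    case 2
    \<comment> \<open>\<open>M + 2\<close> is no power of 3, so 5 divides it and not
      \<open>M\<close>; hence \<open>M\<close> is a power of 3, and then \<open>M + 2\<close> is one
      of 5.\<close>
    have f: "p = 3 \<or> p = 5" if "i < 2" "prime p" "p dvd M + 2 * i" for i p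
      using odd'[of i p] that sub7 2 by auto
    have "5 dvd M + 2"
    proof (rule ccontr)
      assume "\<not> 5 dvd M + 2"
      then obtain k where "M + 2 = 3 ^ k"
        using only_prime_factor_power[of "M + 2" 3] f[of 1] by auto
      then show False using pow[of k] 2 by simp
    qed
    then have "\<not> 5 dvd M" by presburger
    then obtain a where a: "M = 3 ^ a" using only_prime_factor_power[of M 3] f[of 0] M by auto
    have "a \<ge> 2"
    proof (rule ccontr)
      assume "\<not> a \<ge> 2"
      then have "a = 0 \<or> a = 1" by arith
      then show False using a M 2 by auto
    qed
    then have "3 dvd M" unfolding a by (intro dvd_power) simp
    then have "\<not> 3 dvd M + 2" by presburger
    then obtain b where "M + 2 = 5 ^ b" using only_prime_factor_power[of "M + 2" 5] f[of 1] by auto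
    then show False using pow5_ne_pow3_plus_2[OF \<open>a \<ge> 2\<close>, of b] a by simp
  next
    case 3
    have f: "p = 3 \<or> p = 5 \<or> p = 7" if "i < 3" "prime p" "p dvd M + 2 * i" for i p
      using odd'[of i p] that sub7 3 by auto
    have ex: "3 dvd M + 2 * i \<or> 5 dvd M + 2 * i \<or> 7 dvd M + 2 * i" if "i < 3" for i
    proof -
      have "M + 2 * i \<noteq> 1" using M 3 by simp
      then obtain p where "prime p" "p dvd M + 2 * i" using prime_factor_nat by blast
      then show ?thesis using f[OF that] by blast
    qed
    have only: "\<exists>k. M + 2 * i = q ^ k" if "i < 3" "prime q" "\<And>p. p \<in> {3, 5, 7} - {q} \<Longrightarrow> \<not> p dvd M + 2 * i" for i q
    proof -
      have "M + 2 * i > 0" using M 3 by simp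
      moreover have "p = q" if "prime p" "p dvd M + 2 * i" for p
        using f[OF \<open>i < 3\<close> that] that(2) \<open>\<And>p. p \<in> {3, 5, 7} - {q} \<Longrightarrow> \<not> p dvd M + 2 * i\<close>[of p] by auto
      ultimately show ?thesis using only_prime_factor_power \<open>prime q\<close> by metis
    qed
    have dis: "\<not> (q dvd M + 2 * i \<and> q dvd M + 2 * j)" if "q \<in> {3, 5, 7}" "i < j" "j < 3" for q i j :: nat
    proof
      assume "q dvd M + 2 * i \<and> q dvd M + 2 * j"
      then have "q dvd (M + 2 * j) - (M + 2 * i)" by (intro dvd_diff_nat) auto
      also have "(M + 2 * j) - (M + 2 * i) = 2 * (j - i)" by simp
      finally have "q dvd 2 * (j - i)" .
      moreover have "j - i = 1 \<or> j - i = 2" using that by arith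
      ultimately show False using that(1) by auto
    qed
    have m3: "(3::nat) ^ k mod 8 = 1 \<or> (3::nat) ^ k mod 8 = 3" for k
      using power_mod_periodic[of 3 2 8 k] by (cases "even k") (auto simp: odd_iff_mod_2_eq_one)
    have m5: "(5::nat) ^ k mod 8 = 1 \<or> (5::nat) ^ k mod 8 = 5" for k
      using power_mod_periodic[of 5 2 8 k] by (cases "even k") (auto simp: odd_iff_mod_2_eq_one)
    have m7: "(7::nat) ^ k mod 8 = 1 \<or> (7::nat) ^ k mod 8 = 7" for k
      using power_mod_periodic[of 7 2 8 k] by (cases "even k") (auto simp: odd_iff_mod_2_eq_one)
    have no3: "3 dvd M + 2 * 2 \<Longrightarrow> \<not> (5 dvd M + 2 * 2 \<or> 7 dvd M + 2 * 2) \<Longrightarrow> False"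
    proof -
      assume "3 dvd M + 2 * 2" "\<not> (5 dvd M + 2 * 2 \<or> 7 dvd M + 2 * 2)"
      then have "\<exists>k. M + 2 * 2 = 3 ^ k" using primes by (intro only) auto
      then show False using pow 3 by auto
    qed
    have no35: "M + 2 * i = 3 ^ a \<Longrightarrow> M + 2 * (i + 1) = 5 ^ b \<Longrightarrow> False" for i a b
    proof -
      assume a: "M + 2 * i = 3 ^ a" and b: "M + 2 * (i + 1) = 5 ^ b"
      have "a \<ge> 2"
      proof (rule ccontr)
        assume "\<not> a \<ge> 2"
        then have "a = 0 \<or> a = 1" by arith
        then show False using a M 3 by auto
      qed
      then show False using pow5_ne_pow3_plus_2[of a b] a b by simp
    qed
    \<comment> \<open>No two of the three terms share an odd prime, so 3, 5 and 7 go to one term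
      each and the terms are prime powers. Of the six orders, the two with 3 last contradict
      \<open>pow\<close>, two contain a power of 3 followed by a power of 5, and two fail modulo
      8.\<close>
    note d01 = dis[of _ 0 1] and d02 = dis[of _ 0 2] and d12 = dis[of _ 1 2]
    consider
      "3 dvd M + 2 * 0" "5 dvd M + 2 * 1" "7 dvd M + 2 * 2"
      | "7 dvd M + 2 * 0" "3 dvd M + 2 * 1" "5 dvd M + 2 * 2"
      | "3 dvd M + 2 * 2"
      | "5 dvd M + 2 * 0" "3 dvd M + 2 * 1" "7 dvd M + 2 * 2"
      | "3 dvd M + 2 * 0" "7 dvd M + 2 * 1" "5 dvd M + 2 * 2"
      using ex[of 0] ex[of 1] ex[of 2] d01[of 3] d01[of 5] d01[of 7] d02[of 3] d02[of 5] d02[of 7]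
        d12[of 3] d12[of 5] d12[of 7] by simp blast
    then show False
    proof cases
      case 1
      have "\<exists>k. M + 2 * 0 = 3 ^ k" using 1 d01 d02 primes by (intro only) auto
      moreover have "\<exists>k. M + 2 * (0 + 1) = 5 ^ k" using 1 d01 d12 primes by (intro only) auto
      ultimately show False using no35 by blast
    next
      case 2
      have "\<exists>k. M + 2 * 1 = 3 ^ k" using 2 d01 d12 primes by (intro only) auto
      moreover have "\<exists>k. M + 2 * (1 + 1) = 5 ^ k" using 2 d02[of 5] d12[of 3] d02[of 7] primes by (intro only) (auto simp: numeral_2_eq_2)
      ultimately show False using no35 by blast
    next
      case 3
      have "\<not> 3 dvd M + 2 * 0" "\<not> 3 dvd M + 2 * 1" using 3 d02[of 3] d12[of 3] by auto
      then have "5 dvd M + 2 * 0 \<and> 7 dvd M + 2 * 1 \<or> 7 dvd M + 2 * 0 \<and> 5 dvd M + 2 * 1"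
        using ex[of 0] ex[of 1] d01[of 5] d01[of 7] by auto
      then have "\<not> 5 dvd M + 2 * 2" "\<not> 7 dvd M + 2 * 2" using d02[of 5] d02[of 7] d12[of 5] d12[of 7] by auto
      then show False using no3 3 by blast
    next
      case 4
      have "\<exists>k. M + 2 * 0 = 5 ^ k" using 4 d01 d02 primes by (intro only) auto
      moreover have "\<exists>k. M + 2 * 1 = 3 ^ k" using 4 d01 d12 primes by (intro only) auto
      moreover have "\<exists>k. M + 2 * 2 = 7 ^ k" using 4 d02 d12 primes by (intro only) auto
      ultimately obtain a b c where "M + 2 * 0 = 5 ^ b" "M + 2 * 1 = 3 ^ a" "M + 2 * 2 = 7 ^ c" by blast
      then have "M mod 8 = 1 \<or> M mod 8 = 5" "(M + 2) mod 8 = 1 \<or> (M + 2) mod 8 = 3"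
          "(M + 4) mod 8 = 1 \<or> (M + 4) mod 8 = 7"
        using m3[of a] m5[of b] m7[of c] by simp_all
      then show False using mod_add_left_eq[of M 8 2] mod_add_left_eq[of M 8 4] by auto
    next
      case 5
      have "\<exists>k. M + 2 * 0 = 3 ^ k" using 5 d01 d02 primes by (intro only) auto
      moreover have "\<exists>k. M + 2 * 1 = 7 ^ k" using 5 d01 d12 primes by (intro only) auto
      ultimately obtain a c where "M + 2 * 0 = 3 ^ a" "M + 2 * 1 = 7 ^ c" by blast
      then have "M mod 8 = 1 \<or> M mod 8 = 3" "(M + 2) mod 8 = 1 \<or> (M + 2) mod 8 = 7"
        using m3[of a] m7[of c] by simp_all
      then show False using mod_add_left_eq[of M 8 2] by auto
    qed
  next
    case 4
    show False by (rule no_smooth_run_small[OF M 4]) (rule smooth)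
  next
    case 5
    show False
    proof (cases "l ^ 2 \<le> M")
      case True
      show False by (rule no_smooth_run_far[OF M(1) True 5]) (rule smooth)
    next
      case False
      then have "M < l ^ 2" by simp
      show False by (rule no_smooth_run_near[OF M \<open>M < l ^ 2\<close> 5]) (rule smooth)
    qed
  qed
qed

section \<open>Expansions in powers of a monic polynomial\<close>

text \<open>Divisibility modulo \<open>p\<close> is phrased in \<open>int poly\<close>, so that
  degrees and leading coefficients remain those of the integral polynomials.\<close>

definition cong_dvd :: "int \<Rightarrow> int poly \<Rightarrow> int poly \<Rightarrow> bool" where
  "cong_dvd p a b \<longleftrightarrow> (\<exists>h. [:p:] dvd b - a * h)"

lemma dvdm_iff_cong_dvd: "poly_mod.dvdm p a b \<longleftrightarrow> cong_dvd p a b"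
proof -
  have "poly_mod.Mp p b = poly_mod.Mp p (a * h) \<longleftrightarrow> [:p:] dvd b - a * h" for h
    by (simp add: poly_eq_iff poly_mod.Mp_coeff poly_mod.M_def const_poly_dvd_iff mod_eq_dvd_iff)
  then show ?thesis by (simp add: poly_mod.dvdm_def cong_dvd_def)
qed

lemma monic_division:
  fixes f a :: "int poly"
  assumes "lead_coeff a = 1" "degree a > 0"
  obtains q r where "f = a * q + r" "degree r < degree a"
proof -
  obtain q r where qr: "pseudo_divmod f a = (q, r)" by force
  have "a \<noteq> 0" using assms by auto
  from pseudo_divmod[OF this qr] show ?thesis using assms that[of q r] by auto
qed

lemma monic_mult_degree_eq_0:
  fixes a q :: "int poly"
  assumes "lead_coeff a = 1" "degree (a * q) < degree a"
  shows "q = 0"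
proof (rule ccontr)
  assume "q \<noteq> 0"
  moreover have "a \<noteq> 0" using assms by auto
  ultimately have "degree (a * q) = degree a + degree q" by (simp add: degree_mult_eq)
  then show False using assms by simp
qed

lemma monic_division_unique:
  fixes a q r :: "int poly"
  assumes "lead_coeff a = 1" "a * q + r = a * q' + r'" "degree r < degree a" "degree r' < degree a"
  shows "q = q'" "r = r'"
proof -
  have "a * (q - q') = r' - r" using assms(2) by (simp add: algebra_simps)
  moreover have "degree (r' - r) < degree a" using assms by (intro degree_diff_less)
  ultimately have "q - q' = 0" using monic_mult_degree_eq_0[OF assms(1)] by metis
  then show "q = q'" by simp
  then show "r = r'" using assms(2) by simp
qed

lemma monic_power_degree:
  fixes a :: "int poly"
  assumes "lead_coeff a = 1"
  shows "lead_coeff (a ^ i) = 1" "degree (a ^ i) = i * degree a"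
proof -
  show "lead_coeff (a ^ i) = 1" using assms by (simp add: lead_coeff_power)
  have "a \<noteq> 0" using assms by auto
  then show "degree (a ^ i) = i * degree a" by (simp add: degree_power_eq)
qed

lemma cong_dvd_small:
  assumes "lead_coeff a = 1" "cong_dvd p a r" "degree r < degree a"
  shows "[:p:] dvd r"
proof -
  obtain h k where "r - a * h = [:p:] * k" using assms(2) by (auto simp: cong_dvd_def elim: dvdE)
  then have r: "r = a * h + [:p:] * k" by (simp add: algebra_simps)
  obtain q s where qs: "k = a * q + s" "degree s < degree a"
    using monic_division[OF assms(1)] assms(3) by (metis gr_zeroI not_less_zero)
  have "r = a * (h + [:p:] * q) + [:p:] * s" using r qs by (simp add: algebra_simps)
  moreover have "degree ([:p:] * s) < degree a" using qs(2) by simp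
  ultimately have "r = [:p:] * s"
    using monic_division_unique(2)[OF assms(1), of 0 r "h + [:p:] * q" "[:p:] * s"] assms(3) by simp
  then show ?thesis by (metis dvd_triv_left)
qed

lemma cong_dvd_diff_mult:
  assumes "cong_dvd p \<phi> a" "cong_dvd p \<phi> b"
  shows "cong_dvd p \<phi> (a - c * b)"
proof -
  obtain x y where xy: "[:p:] dvd a - \<phi> * x" "[:p:] dvd b - \<phi> * y" using assms by (auto simp: cong_dvd_def)
  have "[:p:] dvd (a - \<phi> * x) - c * (b - \<phi> * y)" by (rule dvd_diff[OF xy(1) dvd_mult[OF xy(2)]])
  then have "[:p:] dvd (a - c * b) - \<phi> * (x - c * y)" by (simp add: algebra_simps)
  then show ?thesis unfolding cong_dvd_def by blast
qed

lemma cong_dvd_cong: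
  assumes "cong_dvd p \<phi> a" "[:p:] dvd a - b"
  shows "cong_dvd p \<phi> b"
proof -
  obtain x where x: "[:p:] dvd a - \<phi> * x" using assms by (auto simp: cong_dvd_def)
  have "[:p:] dvd (a - \<phi> * x) - (a - b)" by (rule dvd_diff[OF x assms(2)])
  then have "[:p:] dvd b - \<phi> * x" by (simp add: algebra_simps)
  then show ?thesis unfolding cong_dvd_def by blast
qed

lemma monic_multiple_mod:
  fixes r :: "int poly"
  assumes p: "prime p" and r: "\<not> [:p:] dvd r"
  obtains u s where "[:p:] dvd smult u r - s" "lead_coeff s = 1" "degree s \<le> degree r"
proof -
  interpret poly_mod p .
  define r' where "r' = Mp r"
  have rr': "[:p:] dvd r - r'"
    by (simp add: r'_def const_poly_dvd_iff Mp_coeff M_def mod_eq_dvd_iff[symmetric])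
  have "r' \<noteq> 0" using rr' r by auto
  then have nz: "lead_coeff r' \<noteq> 0" by simp
  have "0 \<le> lead_coeff r'" "lead_coeff r' < p"
    using p prime_gt_0_int by (simp_all add: r'_def Mp_coeff M_def)
  then have "\<not> p dvd lead_coeff r'" using nz zdvd_not_zless[of "lead_coeff r'" p] by linarith
  then have "coprime p (lead_coeff r')" using p by (intro prime_imp_coprime) auto
  then have "coprime (lead_coeff r') p" by (simp add: ac_simps)
  then obtain u where u: "p dvd lead_coeff r' * u - 1"
    using coprime_iff_invertible_int[of "lead_coeff r'" p] by (auto simp: cong_iff_dvd_diff)
  \<comment> \<open>The leading coefficient of \<open>smult u r'\<close> is merely congruent to 1;
    the monomial, a multiple of \<open>p\<close>, makes it equal to 1.\<close>
  define s where "s = smult u r' + monom (1 - u * lead_coeff r') (degree r')"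
  have coeff_s: "coeff s (degree r') = 1" by (simp add: s_def)
  have "degree s \<le> degree r'" unfolding s_def
    using degree_smult_le[of u r'] degree_monom_le[of "1 - u * lead_coeff r'" "degree r'"] by (intro degree_add_le)
  then have deg: "degree s = degree r'" using le_degree[of s "degree r'"] coeff_s by simp
  have "[:p:] dvd smult u (r - r') - monom (1 - u * lead_coeff r') (degree r')"
  proof (rule dvd_diff)
    show "[:p:] dvd smult u (r - r')" using rr' by (rule dvd_smult)
    have "p dvd 1 - u * lead_coeff r'" using u by (simp add: dvd_diff_commute mult.commute)
    then show "[:p:] dvd monom (1 - u * lead_coeff r') (degree r')" by (simp add: const_poly_dvd_iff)
  qed
  then have "[:p:] dvd smult u r - s" by (simp add: s_def smult_diff_right algebra_simps)
  moreover have "degree r' \<le> degree r" unfolding r'_def by (rule degree_m_le_degree)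
  ultimately show ?thesis using that deg coeff_s by simp
qed

text \<open>A monic \<open>h\<close> of least degree with \<open>h g \<in> (p, \<phi>)\<close> divides modulo \<open>p\<close> every \<open>k\<close> with \<open>k g \<in> (p, \<phi>)\<close>,
  in particular \<open>\<phi>\<close> itself.\<close>

lemma irreducible_mod_prime_cong:
  fixes f g :: "int poly"
  assumes p: "prime p" and monic: "lead_coeff \<phi> = 1" and irr: "irreducible_mod p \<phi>"
    and dvd: "cong_dvd p \<phi> (f * g)"
  shows "cong_dvd p \<phi> f \<or> cong_dvd p \<phi> g"
proof (rule ccontr)
  assume contr: "\<not> (cong_dvd p \<phi> f \<or> cong_dvd p \<phi> g)"
  have "cong_dvd p \<phi> (\<phi> * g)" unfolding cong_dvd_def by (rule exI[of _ g]) simp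
  then have "\<exists>h. lead_coeff h = 1 \<and> cong_dvd p \<phi> (h * g)" using monic by blast
  from ex_has_least_nat[of "\<lambda>h. lead_coeff h = 1 \<and> cong_dvd p \<phi> (h * g)" _ degree, OF someI_ex[OF this]]
  obtain h where h: "lead_coeff h = 1" "cong_dvd p \<phi> (h * g)"
    and least: "\<And>k. lead_coeff k = 1 \<Longrightarrow> cong_dvd p \<phi> (k * g) \<Longrightarrow> degree h \<le> degree k" by blast
  have deg: "degree h > 0"
  proof (rule ccontr)
    assume "\<not> degree h > 0"
    then have "h = 1" using h(1) by (metis degree_0_id gr0I lead_coeff_1 degree_1 poly_eqI coeff_eq_0 not_gr0 le_degree)
    then show False using h(2) contr by simp
  qed
  have div: "\<exists>q. [:p:] dvd k - h * q" if k: "cong_dvd p \<phi> (k * g)" for k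
  proof -
    obtain q r where qr: "k = h * q + r" "degree r < degree h" using monic_division[OF h(1) deg] .
    have "[:p:] dvd r"
    proof (rule ccontr)
      assume "\<not> [:p:] dvd r"
      then obtain u s where s: "[:p:] dvd smult u r - s" "lead_coeff s = 1" "degree s \<le> degree r"
        using monic_multiple_mod[OF p] by blast
      have "r * g = k * g - q * (h * g)" by (simp add: qr(1) algebra_simps)
      then have "cong_dvd p \<phi> (r * g)" using cong_dvd_diff_mult[OF k h(2)] by simp
      moreover have "cong_dvd p \<phi> 0" unfolding cong_dvd_def by (rule exI[of _ 0]) simp
      ultimately have "cong_dvd p \<phi> (smult u r * g)"
        using cong_dvd_diff_mult[of p \<phi> 0 "r * g" "[:- u:]"] by simp
      moreover have "[:p:] dvd smult u r * g - s * g" using s(1) by (metis dvd_mult2 left_diff_distrib)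
      ultimately have "cong_dvd p \<phi> (s * g)" by (rule cong_dvd_cong)
      then show False using least[OF s(2)] s(3) qr(2) by simp
    qed
    then show ?thesis using qr(1) by (intro exI[of _ q]) simp
  qed
  obtain q where q: "[:p:] dvd \<phi> - h * q" using div \<open>cong_dvd p \<phi> (\<phi> * g)\<close> by blast
  interpret poly_mod p .
  have "Mp \<phi> = Mp (h * q)"
    using q by (simp add: poly_eq_iff Mp_coeff M_def const_poly_dvd_iff mod_eq_dvd_iff)
  then have "h dvdm 1 \<or> q dvdm 1"
    using irr unfolding irreducible_mod_def irreducible_m_def by blast
  then show False
  proof
    assume "h dvdm 1"
    then have "[:p:] dvd 1"
      using cong_dvd_small[OF h(1), of p 1] deg by (simp add: dvdm_iff_cong_dvd)
    then show False using p by (auto simp: const_poly_dvd_iff not_prime_unit dest: spec[of _ 0])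
  next
    assume "q dvdm 1"
    then obtain x where x: "[:p:] dvd 1 - q * x" by (auto simp: dvdm_iff_cong_dvd cong_dvd_def)
    obtain q' where q': "[:p:] dvd f - h * q'" using div dvd by blast
    \<comment> \<open>Modulo \<open>p\<close>:
      \<open>f = h * q' = h * q * x * q' = \<phi> * x * q'\<close>.\<close>
    have "[:p:] dvd (f - h * q') + h * q' * (1 - q * x) - q' * x * (\<phi> - h * q)"
      by (rule dvd_diff[OF dvd_add[OF q' dvd_mult[OF x]] dvd_mult[OF q]])
    then have "[:p:] dvd f - \<phi> * (q' * x)" by (simp add: algebra_simps)
    then show False using contr unfolding cong_dvd_def by blast
  qed
qed

text \<open>Irreducibility enters the weight argument as \<open>prime_cong\<close>: the ideal
  generated by \<open>p\<close> and \<open>\<phi>\<close> is prime.\<close>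

locale adic =
  fixes p :: int and \<phi> :: "int poly"
  assumes p: "prime p" and monic: "lead_coeff \<phi> = 1" and deg: "degree \<phi> > 0"
    and prime_cong: "cong_dvd p \<phi> (a * b) \<Longrightarrow> cong_dvd p \<phi> a \<or> cong_dvd p \<phi> b"
begin

lemma prime_p: "prime_elem [:p:]"
  using p by (intro lift_prime_elem_poly prime_imp_prime_elem)

lemma p_not_dvd_monic: "lead_coeff a = 1 \<Longrightarrow> \<not> [:p:] dvd a"
  using p not_prime_unit by (metis const_poly_dvd_iff)

lemmas phi_power = monic_power_degree[OF monic]

lemma cong_dvd_degree:
  assumes "lead_coeff a = 1" "cong_dvd p a g" "\<not> p dvd lead_coeff g"
  shows "degree a \<le> degree g"
proof (rule ccontr)
  assume "\<not> degree a \<le> degree g"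
  then have "[:p:] dvd g" using cong_dvd_small[OF assms(1,2)] by simp
  then show False using assms(3) by (simp add: const_poly_dvd_iff)
qed

text \<open>Once \<open>\<phi> ^ i\<close> and \<open>\<phi> ^ j\<close> are split off, cancelling
  the monic \<open>\<phi> ^ N\<close> shows that \<open>\<phi>\<close> divides the product of the
  cofactors modulo \<open>p\<close>, so one of the exponents can grow.\<close>

lemma cong_dvd_power_mult:
  assumes "cong_dvd p (\<phi> ^ N) (g * h)"
  shows "\<exists>i j. i + j = N \<and> cong_dvd p (\<phi> ^ i) g \<and> cong_dvd p (\<phi> ^ j) h"
  using assms
proof (induction N)
  case 0
  then show ?case by (auto simp: cong_dvd_def intro: exI[of _ g] exI[of _ h])
next
  case (Suc N)
  obtain x where x: "[:p:] dvd g * h - \<phi> ^ Suc N * x" using Suc.prems by (auto simp: cong_dvd_def)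
  then have "[:p:] dvd g * h - \<phi> ^ N * (\<phi> * x)" by (simp add: mult_ac)
  then have "cong_dvd p (\<phi> ^ N) (g * h)" unfolding cong_dvd_def by blast
  then obtain i j a b where ij: "i + j = N" "[:p:] dvd g - \<phi> ^ i * a" "[:p:] dvd h - \<phi> ^ j * b"
    using Suc.IH unfolding cong_dvd_def by blast
  have "[:p:] dvd (g - \<phi> ^ i * a) * h + \<phi> ^ i * a * (h - \<phi> ^ j * b)" using ij by (intro dvd_add dvd_mult dvd_mult2)
  also have "\<dots> = g * h - \<phi> ^ N * (a * b)" using ij(1) by (auto simp: algebra_simps power_add)
  finally have "[:p:] dvd (g * h - \<phi> ^ Suc N * x) - (g * h - \<phi> ^ N * (a * b))" by (rule dvd_diff[OF x])
  also have "\<dots> = \<phi> ^ N * (a * b - \<phi> * x)" by (simp add: algebra_simps)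
  finally have "[:p:] dvd a * b - \<phi> * x"
    using prime_elem_dvd_multD[OF prime_p] p_not_dvd_monic[OF phi_power(1)] by blast
  then have "cong_dvd p \<phi> a \<or> cong_dvd p \<phi> b" by (intro prime_cong) (auto simp: cong_dvd_def)
  moreover have *: "cong_dvd p (\<phi> ^ Suc i) g" if "[:p:] dvd g - \<phi> ^ i * a" "cong_dvd p \<phi> a" for i g a
  proof -
    obtain y where "[:p:] dvd a - \<phi> * y" using \<open>cong_dvd p \<phi> a\<close> by (auto simp: cong_dvd_def)
    then have "[:p:] dvd (g - \<phi> ^ i * a) + \<phi> ^ i * (a - \<phi> * y)" using that by (intro dvd_add dvd_mult)
    then have "[:p:] dvd g - \<phi> ^ Suc i * y" by (simp add: algebra_simps)
    then show ?thesis by (auto simp: cong_dvd_def)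
  qed
  moreover have "cong_dvd p (\<phi> ^ i) g" "cong_dvd p (\<phi> ^ j) h" using ij by (auto simp: cong_dvd_def)
  ultimately show ?case
  proof (elim disjE)
    assume "cong_dvd p \<phi> a"
    then show ?case using *[OF ij(2)] \<open>cong_dvd p (\<phi> ^ j) h\<close> ij(1)
      by (intro exI[of _ "Suc i"] exI[of _ j]) auto
  next
    assume "cong_dvd p \<phi> b"
    then show ?case using *[OF ij(3)] \<open>cong_dvd p (\<phi> ^ i) g\<close> ij(1)
      by (intro exI[of _ i] exI[of _ "Suc j"]) auto
  qed
qed

section \<open>Expansions in powers of \<open>\<phi>\<close> and their weights\<close>

lemma expansion_exists:
  assumes "degree g < N * degree \<phi>"
  shows "\<exists>d. (\<forall>i. degree (d i) < degree \<phi>) \<and> g = (\<Sum>i<N. d i * \<phi> ^ i)"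
  using assms
proof (induction N arbitrary: g)
  case (Suc N)
  obtain q r where qr: "g = \<phi> * q + r" "degree r < degree \<phi>" using monic_division[OF monic deg] by blast
  show ?case
  proof (cases "q = 0")
    case True
    then show ?thesis using qr deg
      by (intro exI[of _ "\<lambda>i. if i = 0 then r else 0"])
        (auto simp: sum.lessThan_Suc_shift simp del: sum.lessThan_Suc)
  next
    case False
    have "\<phi> * q = g - r" using qr(1) by simp
    moreover have "degree (g - r) < Suc N * degree \<phi>" using qr(2) Suc.prems by (intro degree_diff_less) auto
    moreover have "degree (\<phi> * q) = degree \<phi> + degree q" using False deg by (subst degree_mult_eq) auto
    ultimately have "degree q < N * degree \<phi>" by simp
    then obtain d where d: "\<forall>i. degree (d i) < degree \<phi>" "q = (\<Sum>i<N. d i * \<phi> ^ i)" using Suc.IH by blast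
    have "g = (\<Sum>i<Suc N. (case i of 0 \<Rightarrow> r | Suc j \<Rightarrow> d j) * \<phi> ^ i)"
      unfolding sum.lessThan_Suc_shift qr(1) d(2) by (simp add: sum_distrib_left mult_ac add.commute)
    then show ?thesis using d(1) qr(2) by (intro exI[of _ "case_nat r d"]) (auto split: nat.splits)
  qed
qed simp

lemma expansion_unique:
  assumes "(\<Sum>i<N. d i * \<phi> ^ i) = (\<Sum>i<N. d' i * \<phi> ^ i)"
    and "\<And>i. degree (d i) < degree \<phi>" "\<And>i. degree (d' i) < degree \<phi>" "i < N"
  shows "d i = d' i"
  using assms
proof (induction N arbitrary: d d' i)
  case (Suc N)
  have shift: "(\<Sum>i<Suc N. d i * \<phi> ^ i) = \<phi> * (\<Sum>i<N. d (Suc i) * \<phi> ^ i) + d 0" for d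
    unfolding sum.lessThan_Suc_shift by (simp add: sum_distrib_left mult_ac add.commute)
  note eq = Suc.prems(1)[unfolded shift]
  show ?case
  proof (cases i)
    case 0
    then show ?thesis using monic_division_unique(2)[OF monic eq] Suc.prems by simp
  next
    case (Suc j)
    have "(\<Sum>i<N. d (Suc i) * \<phi> ^ i) = (\<Sum>i<N. d' (Suc i) * \<phi> ^ i)"
      using monic_division_unique(1)[OF monic eq] Suc.prems by blast
    then show ?thesis using Suc.IH[of "\<lambda>i. d (Suc i)" "\<lambda>i. d' (Suc i)" j] Suc.prems Suc by simp
  qed
qed simp

text \<open>Division by a monic polynomial commutes with scaling by \<open>p ^ e\<close>, by
  uniqueness of quotient and remainder.\<close>

lemma division_p_power:
  assumes "c = \<phi> * Q + R" "degree R < degree \<phi>" "[:p:] ^ e dvd c"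
  shows "[:p:] ^ e dvd Q" "[:p:] ^ e dvd R"
proof -
  obtain c' where c': "c = [:p:] ^ e * c'" using assms(3) by (elim dvdE)
  obtain Q' R' where QR: "c' = \<phi> * Q' + R'" "degree R' < degree \<phi>" using monic_division[OF monic deg] by blast
  have "[:p:] ^ e = [:p ^ e:]" by (simp add: poly_const_pow)
  then have "degree ([:p:] ^ e * R') < degree \<phi>" using QR(2) by simp
  moreover have "\<phi> * Q + R = \<phi> * ([:p:] ^ e * Q') + [:p:] ^ e * R'"
    using assms(1) c' QR(1) by (simp add: algebra_simps)
  ultimately have "Q = [:p:] ^ e * Q'" "R = [:p:] ^ e * R'"
    using monic_division_unique[OF monic] assms(2) by blast+
  then show "[:p:] ^ e dvd Q" "[:p:] ^ e dvd R" by simp_all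
qed

lemma remainder_not_dvd:
  assumes "a * b = \<phi> * Q + R" "degree R < degree \<phi>" "degree a < degree \<phi>" "degree b < degree \<phi>"
    "\<not> [:p:] dvd a" "\<not> [:p:] dvd b"
  shows "\<not> [:p:] dvd R"
proof
  assume "[:p:] dvd R"
  then have "[:p:] dvd a * b - \<phi> * Q" using assms(1) by simp
  then have "cong_dvd p \<phi> (a * b)" by (auto simp: cong_dvd_def)
  then show False using prime_cong cong_dvd_small[OF monic] assms by blast
qed

text \<open>\<open>heavy w s i c\<close>: the term \<open>c \<phi>\<^sup>i\<close> has weight at least \<open>s\<close> when \<open>p\<close> has weight \<open>w\<close> and \<open>\<phi>\<close>
  has weight \<open>1\<close>. The resulting valuation on expansions is the one whose lower bounds are the lines
  of slope \<open>1 / w\<close> below the Newton polygon.\<close>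

definition heavy :: "nat \<Rightarrow> nat \<Rightarrow> nat \<Rightarrow> int poly \<Rightarrow> bool" where
  "heavy w s i c \<longleftrightarrow> (\<exists>e. s \<le> w * e + i \<and> [:p:] ^ e dvd c)"

lemma heavy_mono: "heavy w s i c \<Longrightarrow> s' \<le> s \<Longrightarrow> heavy w s' i c"
  unfolding heavy_def using order_trans by blast

lemma heavy_Suc: "heavy w s i c \<Longrightarrow> heavy w (Suc s) (Suc i) c"
  by (auto simp: heavy_def)

lemma heavy_0: "w > 0 \<Longrightarrow> heavy w s i 0"
  unfolding heavy_def by (rule exI[of _ s]) (cases w, auto)

lemma heavy_add:
  assumes "heavy w s i c" "heavy w s i d"
  shows "heavy w s i (c + d)"
proof -
  obtain e e' where e: "s \<le> w * e + i" "[:p:] ^ e dvd c" "s \<le> w * e' + i" "[:p:] ^ e' dvd d"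
    using assms by (auto simp: heavy_def)
  have "[:p:] ^ min e e' dvd c" "[:p:] ^ min e e' dvd d"
    using e power_le_dvd by (metis min.cobounded1, metis min.cobounded2 e(4) power_le_dvd)
  then have "[:p:] ^ min e e' dvd c + d" by (rule dvd_add)
  moreover have "s \<le> w * min e e' + i" using e by (simp add: min_def)
  ultimately show ?thesis by (auto simp: heavy_def)
qed

lemma heavy_minus: "heavy w s i (- c) \<longleftrightarrow> heavy w s i c"
  by (simp add: heavy_def)

lemma heavy_sum: "w > 0 \<Longrightarrow> (\<And>x. x \<in> X \<Longrightarrow> heavy w s i (f x)) \<Longrightarrow> heavy w s i (sum f X)"
  by (induction X rule: infinite_finite_induct) (auto simp: heavy_0 intro: heavy_add)

text \<open>\<open>Q\<close> is a carry into position \<open>i + j + 1\<close>, but its weight is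
  measured at \<open>i + j\<close>; the move then adds 1, the gain on which
  \<open>weight_product\<close> rests.\<close>

lemma heavy_division:
  assumes "heavy w s i c" "heavy w t j d" "c * d = \<phi> * Q + R" "degree R < degree \<phi>"
  shows "heavy w (s + t) (i + j) Q" "heavy w (s + t) (i + j) R"
proof -
  obtain e e' where e: "s \<le> w * e + i" "[:p:] ^ e dvd c" "t \<le> w * e' + j" "[:p:] ^ e' dvd d"
    using assms by (auto simp: heavy_def)
  have "[:p:] ^ (e + e') dvd c * d" using e unfolding power_add by (intro mult_dvd_mono)
  moreover have "s + t \<le> w * (e + e') + (i + j)" using e by (simp add: algebra_simps)
  ultimately show "heavy w (s + t) (i + j) Q" "heavy w (s + t) (i + j) R"
    using division_p_power[OF assms(3,4)] unfolding heavy_def by blast+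
qed

lemma heavy_exact:
  assumes "w > 0" "heavy w s i c" "\<not> heavy w (Suc s) i c"
  obtains e u where "c = [:p:] ^ e * u" "s = w * e + i" "\<not> [:p:] dvd u"
proof -
  obtain e where e: "s \<le> w * e + i" "[:p:] ^ e dvd c" using assms(2) by (auto simp: heavy_def)
  then have s: "s = w * e + i" using assms(3) by (metis heavy_def le_antisym not_less_eq_eq)
  obtain u where u: "c = [:p:] ^ e * u" using e(2) by (elim dvdE)
  have "\<not> [:p:] dvd u"
  proof
    assume "[:p:] dvd u"
    then have "[:p:] ^ Suc e dvd c" unfolding u power_Suc2 by (intro mult_dvd_mono) simp_all
    then have "heavy w (Suc s) i c" unfolding heavy_def s using assms(1) by (intro exI[of _ "Suc e"]) simp
    then show False using assms(3) by simp
  qed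
  then show ?thesis using that u s by blast
qed

text \<open>Gauss's lemma for the weight: among the terms of minimal weight the lowest powers of \<open>\<phi>\<close> multiply
  without cancellation, since the carries produced by reducing modulo \<open>\<phi>\<close> gain weight.\<close>

lemma weight_product:
  assumes w: "w > 0" and g: "\<And>i. degree (g i) < degree \<phi>" and h: "\<And>j. degree (h j) < degree \<phi>"
    and c: "\<And>i. degree (c i) < degree \<phi>"
    and eq: "(\<Sum>i<K. g i * \<phi> ^ i) * (\<Sum>j<L. h j * \<phi> ^ j) = (\<Sum>i<K + L. c i * \<phi> ^ i)"
    and hg: "\<And>i. i < K \<Longrightarrow> heavy w s i (g i)" and hh: "\<And>j. j < L \<Longrightarrow> heavy w t j (h j)"
    and i0: "i0 < K" "\<not> heavy w (Suc s) i0 (g i0)" "\<And>i. i < i0 \<Longrightarrow> heavy w (Suc s) i (g i)"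
    and j0: "j0 < L" "\<not> heavy w (Suc t) j0 (h j0)" "\<And>j. j < j0 \<Longrightarrow> heavy w (Suc t) j (h j)"
  shows "\<not> heavy w (Suc (s + t)) (i0 + j0) (c (i0 + j0))"
proof
  assume heavy: "heavy w (Suc (s + t)) (i0 + j0) (c (i0 + j0))"
  have "\<exists>Q R. g i * h j = \<phi> * Q + R \<and> degree R < degree \<phi>" for i j
    using monic_division[OF monic deg] by metis
  then obtain Q R where QR: "\<And>i j. g i * h j = \<phi> * Q i j + R i j" "\<And>i j. degree (R i j) < degree \<phi>"
    by metis
  have degQ: "degree (Q i j) < degree \<phi>" for i j
  proof (cases "Q i j = 0")
    case False
    have "\<phi> * Q i j = g i * h j - R i j" using QR(1)[of i j] by simp
    moreover have "degree (g i * h j - R i j) < degree \<phi> + degree \<phi>"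
    proof (rule degree_diff_less)
      show "degree (g i * h j) < degree \<phi> + degree \<phi>"
        using degree_mult_le[of "g i" "h j"] g[of i] h[of j] by linarith
    qed (use QR(2)[of i j] in simp)
    moreover have "degree (\<phi> * Q i j) = degree \<phi> + degree (Q i j)"
      using False deg by (subst degree_mult_eq) auto
    ultimately show ?thesis by simp
  qed (use deg in simp)
  define A where "A = {..<K} \<times> {..<L}"
  \<comment> \<open>The coefficient of \<open>\<phi> ^ n\<close> after carrying: remainders from
    position \<open>n\<close>, quotients from the position before. One round of carries is enough by
    \<open>degQ\<close>.\<close>
  define d where "d n = (\<Sum>x\<in>{x \<in> A. fst x + snd x = n}. R (fst x) (snd x))
      + (\<Sum>x\<in>{x \<in> A. Suc (fst x + snd x) = n}. Q (fst x) (snd x))" for n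
  have finA: "finite A" by (simp add: A_def)
  have "(\<Sum>i<K. g i * \<phi> ^ i) * (\<Sum>j<L. h j * \<phi> ^ j)
      = (\<Sum>x\<in>A. (g (fst x) * \<phi> ^ fst x) * (h (snd x) * \<phi> ^ snd x))"
    by (simp add: sum_product sum.cartesian_product A_def case_prod_unfold)
  also have "\<dots> = (\<Sum>x\<in>A. R (fst x) (snd x) * \<phi> ^ (fst x + snd x))
      + (\<Sum>x\<in>A. Q (fst x) (snd x) * \<phi> ^ Suc (fst x + snd x))"
    unfolding sum.distrib[symmetric]
  proof (rule sum.cong[OF refl])
    fix x
    have "(g (fst x) * \<phi> ^ fst x) * (h (snd x) * \<phi> ^ snd x) = (g (fst x) * h (snd x)) * \<phi> ^ (fst x + snd x)"
      by (simp add: power_add mult_ac)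
    then show "(g (fst x) * \<phi> ^ fst x) * (h (snd x) * \<phi> ^ snd x)
        = R (fst x) (snd x) * \<phi> ^ (fst x + snd x) + Q (fst x) (snd x) * \<phi> ^ Suc (fst x + snd x)"
      unfolding QR(1) by (simp add: algebra_simps)
  qed
  also have "(\<Sum>x\<in>A. R (fst x) (snd x) * \<phi> ^ (fst x + snd x))
      = (\<Sum>n<K + L. \<Sum>x\<in>{x \<in> A. fst x + snd x = n}. R (fst x) (snd x) * \<phi> ^ (fst x + snd x))"
    using finA by (intro sum.group[symmetric]) (auto simp: A_def)
  also have "\<dots> = (\<Sum>n<K + L. (\<Sum>x\<in>{x \<in> A. fst x + snd x = n}. R (fst x) (snd x)) * \<phi> ^ n)"
    by (simp add: sum_distrib_right)
  also have "(\<Sum>x\<in>A. Q (fst x) (snd x) * \<phi> ^ Suc (fst x + snd x))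
      = (\<Sum>n<K + L. \<Sum>x\<in>{x \<in> A. Suc (fst x + snd x) = n}. Q (fst x) (snd x) * \<phi> ^ Suc (fst x + snd x))"
    using finA by (intro sum.group[symmetric]) (auto simp: A_def)
  also have "\<dots> = (\<Sum>n<K + L. (\<Sum>x\<in>{x \<in> A. Suc (fst x + snd x) = n}. Q (fst x) (snd x)) * \<phi> ^ n)"
    by (auto simp: sum_distrib_right intro!: sum.cong)
  finally have "(\<Sum>n<K + L. c n * \<phi> ^ n) = (\<Sum>n<K + L. d n * \<phi> ^ n)"
    unfolding eq by (simp add: d_def sum.distrib distrib_right)
  moreover have "degree (d n) < degree \<phi>" for n
    unfolding d_def using QR(2) degQ deg by (intro degree_add_less degree_sum_less) auto
  ultimately have cd: "c (i0 + j0) = d (i0 + j0)"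
    using expansion_unique[of c "K + L" d "i0 + j0"] c i0(1) j0(1) by auto
  define X where "X = {x \<in> A. fst x + snd x = i0 + j0}"
  have X: "(i0, j0) \<in> X" "finite X" using i0 j0 finA by (auto simp: X_def A_def)
  define rest where "rest = (\<Sum>x\<in>X - {(i0, j0)}. R (fst x) (snd x))
      + (\<Sum>x\<in>{x \<in> A. Suc (fst x + snd x) = i0 + j0}. Q (fst x) (snd x))"
  have "c (i0 + j0) = R i0 j0 + rest"
    unfolding cd d_def X_def[symmetric] rest_def using X by (simp add: sum.remove)
  then have R: "R i0 j0 = c (i0 + j0) + (- rest)" by simp
  have "heavy w (Suc (s + t)) (i0 + j0) rest"
    unfolding rest_def
  proof (intro heavy_add heavy_sum w)
    fix x assume x: "x \<in> X - {(i0, j0)}"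
    \<comment> \<open>Any other pair on the diagonal has a coordinate before \<open>i0\<close> or
      \<open>j0\<close>, where the weight exceeds the minimum; hence the choice of lowest
      positions.\<close>
    then have lt: "fst x < i0 \<or> snd x < j0" by (cases x) (auto simp: X_def)
    have ij: "fst x < K" "snd x < L" "fst x + snd x = i0 + j0" using x by (auto simp: X_def A_def)
    have "heavy w (Suc (s + t)) (fst x + snd x) (R (fst x) (snd x))"
      using lt
    proof
      assume "fst x < i0"
      from heavy_division(2)[OF i0(3)[OF this] hh[OF ij(2)] QR] show ?thesis by simp
    next
      assume "snd x < j0"
      from heavy_division(2)[OF hg[OF ij(1)] j0(3)[OF this] QR] show ?thesis by simp
    qed
    then show "heavy w (Suc (s + t)) (i0 + j0) (R (fst x) (snd x))" using ij by simp
  next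
    fix x assume x: "x \<in> {x \<in> A. Suc (fst x + snd x) = i0 + j0}"
    then have "heavy w (s + t) (fst x + snd x) (Q (fst x) (snd x))"
      using heavy_division(1)[OF hg hh QR] by (auto simp: A_def)
    then show "heavy w (Suc (s + t)) (i0 + j0) (Q (fst x) (snd x))" using x heavy_Suc by fastforce
  qed
  then have hR: "heavy w (Suc (s + t)) (i0 + j0) (R i0 j0)"
    unfolding R using heavy by (intro heavy_add) (simp_all add: heavy_minus)
  \<comment> \<open>With all powers of \<open>p\<close> taken out of both coefficients, primality of
    the ideal keeps the remainder of \<open>u * u'\<close> nonzero modulo \<open>p\<close>, so
    \<open>R i0 j0\<close> contains exactly \<open>e + e'\<close> powers.\<close>
  obtain e u where u: "g i0 = [:p:] ^ e * u" "s = w * e + i0" "\<not> [:p:] dvd u"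
    using heavy_exact[OF w hg[OF i0(1)] i0(2)] .
  obtain e' u' where u': "h j0 = [:p:] ^ e' * u'" "t = w * e' + j0" "\<not> [:p:] dvd u'"
    using heavy_exact[OF w hh[OF j0(1)] j0(2)] .
  have p0: "p \<noteq> 0" using p by auto
  have pow: "[:p:] ^ e = [:p ^ e:]" for e by (simp add: poly_const_pow)
  have du: "degree u < degree \<phi>" "degree u' < degree \<phi>"
    using g[of i0] h[of j0] p0 unfolding u(1) u'(1) pow by simp_all
  obtain q r where qr: "u * u' = \<phi> * q + r" "degree r < degree \<phi>" using monic_division[OF monic deg] by blast
  have "\<phi> * Q i0 j0 + R i0 j0 = \<phi> * ([:p:] ^ (e + e') * q) + [:p:] ^ (e + e') * r"
  proof -
    have "\<phi> * Q i0 j0 + R i0 j0 = [:p:] ^ (e + e') * (u * u')"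
      unfolding QR(1)[of i0 j0, symmetric] u(1) u'(1) power_add by (simp only: mult_ac)
    then show ?thesis unfolding qr(1) by (simp only: distrib_left mult.left_commute)
  qed
  then have Rr: "R i0 j0 = [:p:] ^ (e + e') * r"
    by (rule monic_division_unique(2)[OF monic _ QR(2)]) (use qr(2) in \<open>simp add: pow\<close>)
  obtain f where f: "Suc (s + t) \<le> w * f + (i0 + j0)" "[:p:] ^ f dvd R i0 j0"
    using hR by (auto simp: heavy_def)
  have "w * (e + e') < w * f" using f(1) u(2) u'(2) by (simp add: algebra_simps)
  then have "Suc (e + e') \<le> f" by simp
  then have "[:p:] ^ Suc (e + e') dvd [:p:] ^ (e + e') * r" using f(2) Rr power_le_dvd by metis
  then have "[:p:] dvd r" unfolding power_Suc2 dvd_mult_cancel_left using p0 by simp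
  then show False using remainder_not_dvd[OF qr du u(3) u'(3)] by simp
qed

end

context adic begin

text \<open>Terms below \<open>k\<close> have degree less than \<open>k * degree \<phi>\<close>, so
  the leading coefficient of \<open>g\<close> comes from \<open>d k * \<phi> ^ k\<close>.\<close>

lemma expansion_top:
  assumes "g = (\<Sum>i<Suc k. d i * \<phi> ^ i)" "\<And>i. degree (d i) < degree \<phi>"
    and "degree g = k * degree \<phi>" "\<not> p dvd lead_coeff g"
  shows "\<not> [:p:] dvd d k"
proof
  assume "[:p:] dvd d k"
  then have "[:p:] dvd d k * \<phi> ^ k" by simp
  then have "p dvd coeff (d k * \<phi> ^ k) (k * degree \<phi>)" by (simp only: const_poly_dvd_iff)
  moreover have "coeff (d i * \<phi> ^ i) (k * degree \<phi>) = 0" if "i < k" for i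
  proof (rule coeff_eq_0)
    have "degree (d i * \<phi> ^ i) \<le> degree (d i) + i * degree \<phi>"
      using degree_mult_le[of "d i" "\<phi> ^ i"] phi_power(2) by simp
    also have "\<dots> < Suc i * degree \<phi>" using assms(2)[of i] by simp
    also have "\<dots> \<le> k * degree \<phi>" using that by (intro mult_le_mono1) simp
    finally show "degree (d i * \<phi> ^ i) < k * degree \<phi>" .
  qed
  then have "coeff g (k * degree \<phi>) = coeff (d k * \<phi> ^ k) (k * degree \<phi>)"
    unfolding assms(1) by (simp add: coeff_sum)
  ultimately show False using assms(3,4) by simp
qed

text \<open>\<open>s\<close> is the minimal weight of a term and \<open>i0\<close> the lowest
  position attaining it. The top term has weight exactly \<open>k\<close>, whence
  \<open>s \<le> k\<close>.\<close>

lemma maximal_weight: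
  assumes "w > 0" "\<not> [:p:] dvd g k"
  obtains s i0 where "s \<le> k" "\<And>i. i < Suc k \<Longrightarrow> heavy w s i (g i)"
    "i0 < Suc k" "\<not> heavy w (Suc s) i0 (g i0)" "\<And>i. i < i0 \<Longrightarrow> heavy w (Suc s) i (g i)"
proof -
  define S where "S = {s. \<forall>i<Suc k. heavy w s i (g i)}"
  have le: "s \<le> k" if s: "s \<in> S" for s
  proof -
    obtain e where e: "s \<le> w * e + k" "[:p:] ^ e dvd g k" using s by (auto simp: S_def heavy_def)
    have "e = 0" using e(2) assms(2) by (metis dvd_power dvd_trans gr0I)
    then show ?thesis using e(1) by simp
  qed
  then have fin: "finite S" by (meson finite_nat_set_iff_bounded_le)
  have "heavy w 0 i c" for i c by (auto simp: heavy_def intro: exI[of _ 0])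
  then have "0 \<in> S" by (simp add: S_def)
  then have max: "Max S \<in> S" using fin by (intro Max_in) auto
  have "Suc (Max S) \<notin> S" using Max_ge[OF fin, of "Suc (Max S)"] by auto
  then have ex: "\<exists>i. i < Suc k \<and> \<not> heavy w (Suc (Max S)) i (g i)" by (auto simp: S_def)
  define i0 where "i0 = (LEAST i. i < Suc k \<and> \<not> heavy w (Suc (Max S)) i (g i))"
  have i0: "i0 < Suc k \<and> \<not> heavy w (Suc (Max S)) i0 (g i0)" unfolding i0_def using ex by (rule LeastI_ex)
  moreover have "heavy w (Suc (Max S)) i (g i)" if "i < i0" for i
    using not_less_Least[OF that[unfolded i0_def]] that i0 by auto
  ultimately show ?thesis using that[of "Max S" i0] le[OF max] max by (auto simp: S_def)
qed

text \<open>The lowest term of the product has minimal weight, so the lowest term of \<open>G\<close> is also the lightest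
  one; its weight is then at most that of the top term, which is \<open>k < w\<close>.\<close>

lemma factor_not_cong_dvd:
  assumes "k < w"
    and eq: "G * H = (\<Sum>s<Suc k + Suc l. c s * \<phi> ^ s)" and c: "\<And>s. degree (c s) < degree \<phi>"
    and G: "degree G = k * degree \<phi>" "\<not> p dvd lead_coeff G"
    and H: "degree H = l * degree \<phi>" "\<not> p dvd lead_coeff H"
    and heavy: "\<And>s. heavy w (w * V) s (c s)" and exact: "\<not> heavy w (Suc (w * V)) 0 (c 0)"
  shows "\<not> cong_dvd p \<phi> G"
proof
  assume dvd: "cong_dvd p \<phi> G"
  have w: "w > 0" using assms(1) by simp
  obtain g where g: "\<And>i. degree (g i) < degree \<phi>" "G = (\<Sum>i<Suc k. g i * \<phi> ^ i)"
  proof -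
    have "degree G < Suc k * degree \<phi>" using G(1) deg by simp
    then show ?thesis using expansion_exists that by blast
  qed
  obtain h where h: "\<And>i. degree (h i) < degree \<phi>" "H = (\<Sum>i<Suc l. h i * \<phi> ^ i)"
  proof -
    have "degree H < Suc l * degree \<phi>" using H(1) deg by simp
    then show ?thesis using expansion_exists that by blast
  qed
  obtain s i0 where s: "s \<le> k" "\<And>i. i < Suc k \<Longrightarrow> heavy w s i (g i)"
    "i0 < Suc k" "\<not> heavy w (Suc s) i0 (g i0)" "\<And>i. i < i0 \<Longrightarrow> heavy w (Suc s) i (g i)"
    by (rule maximal_weight[where g = g and k = k, OF w expansion_top[OF g(2,1) G]]) (rule that)
  obtain t j0 where "t \<le> l" and t: "\<And>i. i < Suc l \<Longrightarrow> heavy w t i (h i)"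
    "j0 < Suc l" "\<not> heavy w (Suc t) j0 (h j0)" "\<And>i. i < j0 \<Longrightarrow> heavy w (Suc t) i (h i)"
    by (rule maximal_weight[where g = h and k = l, OF w expansion_top[OF h(2,1) H]]) (rule that)
  have "\<not> heavy w (Suc (s + t)) (i0 + j0) (c (i0 + j0))"
    using weight_product[OF w g(1) h(1) c eq[unfolded g(2) h(2)] s(2) t(1) s(3-5) t(2-4)] .
  then have V: "w * V \<le> s + t" using heavy heavy_mono not_less_eq_eq by blast
  have shift: "(\<Sum>i<Suc N. d i * \<phi> ^ i) = \<phi> * (\<Sum>i<N. d (Suc i) * \<phi> ^ i) + d 0" for d N
    unfolding sum.lessThan_Suc_shift by (simp add: sum_distrib_left mult_ac add.commute)
  obtain G' H' C' where ex: "G = \<phi> * G' + g 0" "H = \<phi> * H' + h 0" "G * H = \<phi> * C' + c 0"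
    using g(2) h(2) eq unfolding shift add_Suc by blast
  have "[:p:] dvd g 0"
  proof (rule cong_dvd_small[OF monic _ g(1)])
    obtain x where "[:p:] dvd G - \<phi> * x" using dvd by (auto simp: cong_dvd_def)
    then have "[:p:] dvd g 0 - \<phi> * (x - G')" by (simp add: ex(1) algebra_simps)
    then show "cong_dvd p \<phi> (g 0)" by (auto simp: cong_dvd_def)
  qed
  then have "heavy w w 0 (g 0)" by (auto simp: heavy_def intro!: exI[of _ 1])
  moreover have "heavy w t 0 (h 0)" using t(1) by simp
  \<comment> \<open>\<open>c 0\<close> is the remainder of \<open>g 0 * h 0\<close> modulo
    \<open>\<phi>\<close>, so its weight is at least
    \<open>w + t > s + t \<ge> w * V\<close>.\<close>
  moreover have "g 0 * h 0 = \<phi> * (C' - \<phi> * G' * H' - G' * h 0 - g 0 * H') + c 0"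
    using ex(3) unfolding ex(1,2) by (simp add: algebra_simps)
  ultimately have "heavy w (w + t) 0 (c 0)" using heavy_division(2)[OF _ _ _ c] by fastforce
  then show False using exact V s(1) assms(1) heavy_mono[of w "w + t" 0 "c 0" "Suc (w * V)"] by simp
qed

end

lemma adic_if_irreducible_mod:
  assumes "prime p" "lead_coeff \<phi> = 1" "irreducible_mod p \<phi>"
  shows "adic p \<phi>"
proof -
  have "degree \<phi> \<noteq> 0"
  proof
    assume "degree \<phi> = 0"
    then have "\<phi> = 1" using assms(2) by (metis degree_0_id pCons_one)
    then have "poly_mod.dvdm p \<phi> 1" by (auto simp: poly_mod.dvdm_def intro: exI[of _ 1])
    then show False using assms(3) by (simp add: irreducible_mod_def poly_mod.irreducible_m_def)
  qed
  then show ?thesis using assms irreducible_mod_prime_cong[OF assms] by unfold_locales auto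
qed

section \<open>Products of odd numbers\<close>

definition oddprod :: "nat \<Rightarrow> nat" where
  "oddprod j = (\<Prod>i<Suc j. 2 * i + 1)"

definition oddquot :: "nat \<Rightarrow> nat \<Rightarrow> nat" where
  "oddquot n j = (\<Prod>i\<in>{Suc j..<Suc n}. 2 * i + 1)"

lemma oddfact_eq: "oddfact (2 * j + 2) = oddprod j"
  unfolding oddfact_def oddprod_def
  by (rule prod.reindex_bij_witness[of _ "\<lambda>i. 2 * i + 1" "\<lambda>i. i div 2"]) (auto elim!: oddE)

lemma oddprod_pos: "oddprod j > 0"
  by (auto simp: oddprod_def)

lemma oddprod_quot: "j \<le> n \<Longrightarrow> oddprod n = oddprod j * oddquot n j"
  unfolding oddprod_def oddquot_def lessThan_atLeast0
  by (rule prod.atLeastLessThan_concat[symmetric]) auto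

text \<open>The factors divisible by \<open>p\<close> are \<open>p\<close> times the factors of a shorter product of odd numbers.\<close>

lemma multiplicity_oddprod_le:
  assumes "prime p" "odd p"
  shows "(p - 1) * multiplicity p (oddprod j) \<le> 2 * j"
proof (induction j rule: less_induct)
  case (less j)
  obtain r where r: "p = 2 * r + 1" using assms(2) by (elim oddE)
  have "r < p" using r by simp
  then have div: "(p * x + r) div p = x" for x by simp
  have "r \<ge> 1" using r assms(1) by (cases r) auto
  \<comment> \<open>\<open>2 * i + 1\<close> is an odd multiple \<open>p * (2 * k + 1)\<close>
    exactly when \<open>i = p * k + r\<close>; \<open>c\<close> counts these \<open>i\<close> up to
    \<open>j\<close>.\<close>
  define c where "c = (j + r + 1) div p"
  have cp: "c * p \<le> j + r + 1" unfolding c_def by simp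
  have iff: "i < c \<longleftrightarrow> p * i + r \<le> j" for i
  proof -
    have "i < c \<longleftrightarrow> Suc i * p \<le> j + r + 1" unfolding c_def Suc_le_eq[symmetric]
      using r by (intro less_eq_div_iff_mult_less_eq) simp
    then show ?thesis using r by (simp add: algebra_simps)
  qed
  have mult: "multiplicity p (oddprod k) = (\<Sum>i<Suc k. multiplicity p (2 * i + 1))" for k
    unfolding oddprod_def using assms(1) by (intro prime_elem_multiplicity_prod_distrib) auto
  have "multiplicity p (oddprod j) = (\<Sum>i\<in>{i\<in>{..<Suc j}. p dvd 2 * i + 1}. multiplicity p (2 * i + 1))"
    unfolding mult by (rule sum.mono_neutral_right) (use not_dvd_imp_multiplicity_0 in force)+
  also have "\<dots> = (\<Sum>i<c. multiplicity p (p * (2 * i + 1)))"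
  proof (rule sum.reindex_bij_witness[of _ "\<lambda>i. p * i + r" "\<lambda>i. i div p"])
    fix i assume i: "i \<in> {i\<in>{..<Suc j}. p dvd 2 * i + 1}"
    then obtain q where q: "2 * i + 1 = p * q" by (auto elim: dvdE)
    have "odd (p * q)" using q by (metis odd_two_times_div_two_succ even_add even_mult_iff odd_one even_numeral)
    then have "odd q" by simp
    then obtain k where k: "q = 2 * k + 1" by (elim oddE)
    have ik: "i = p * k + r" using q unfolding k r by (simp add: algebra_simps)
    have "i div p = k" unfolding ik by (rule div)
    moreover have "p * (2 * (i div p) + 1) = 2 * i + 1" unfolding \<open>i div p = k\<close> using q k by simp
    ultimately show "p * (i div p) + r = i" "i div p \<in> {..<c}" "multiplicity p (p * (2 * (i div p) + 1)) = multiplicity p (2 * i + 1)"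
      using i ik iff[of k] by (simp, simp add: less_Suc_eq_le, simp only:)
  next
    fix i assume "i \<in> {..<c}"
    moreover have "2 * (p * i + r) + 1 = p * (2 * i + 1)" using r by (simp add: algebra_simps)
    then have "p dvd 2 * (p * i + r) + 1" by (metis dvd_triv_left)
    ultimately show "(p * i + r) div p = i" "p * i + r \<in> {i\<in>{..<Suc j}. p dvd 2 * i + 1}"
      using iff[of i] div by (simp_all only: mem_Collect_eq lessThan_iff less_Suc_eq_le simp_thms)
  qed
  also have "\<dots> = (\<Sum>i<c. 1 + multiplicity p (2 * i + 1))"
  proof (rule sum.cong[OF refl])
    fix i
    have "multiplicity p (p * (2 * i + 1)) = multiplicity p p + multiplicity p (2 * i + 1)"
      using assms(1) by (intro prime_elem_multiplicity_mult_distrib) (auto simp: prime_gt_0_nat)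
    then show "multiplicity p (p * (2 * i + 1)) = 1 + multiplicity p (2 * i + 1)"
      using assms(1) by (simp add: multiplicity_prime)
  qed
  finally have eq: "multiplicity p (oddprod j) = c + (\<Sum>i<c. multiplicity p (2 * i + 1))"
    unfolding sum.distrib by simp
  show ?case
  proof (cases c)
    case 0
    then show ?thesis using eq by simp
  next
    case (Suc d)
    have "p * d + r \<le> j" using iff[of d] Suc by simp
    then have "d < j" using \<open>r \<ge> 1\<close> r by (simp add: algebra_simps)
    have "multiplicity p (oddprod j) = Suc d + multiplicity p (oddprod d)"
      using eq unfolding Suc mult[of d] .
    then have "(p - 1) * multiplicity p (oddprod j) = (p - 1) * Suc d + (p - 1) * multiplicity p (oddprod d)"
      by (simp only: distrib_left)
    also have "\<dots> \<le> (p - 1) * Suc d + 2 * d" using less[OF \<open>d < j\<close>] by simp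
    also have "\<dots> \<le> 2 * j" using \<open>p * d + r \<le> j\<close> r by (simp add: algebra_simps)
    finally show ?thesis .
  qed
qed

lemma sum_even_odd: "(\<Sum>s<2 * N. f s) = (\<Sum>j<N. f (2 * j) + f (2 * j + 1))" for f :: "nat \<Rightarrow> 'a::comm_monoid_add"
  by (induction N) (auto simp: add_ac)

text \<open>Schur's theorem is applied to the \<open>k div 2\<close> largest factors; they lie so
  high that \<open>2 * t\<close> exceeds \<open>2 * n - k\<close>, the degree of the cofactor in
  units of \<open>degree \<phi>\<close>. For \<open>k = 1\<close> that run would be empty, and any
  prime factor of \<open>2 * n + 1\<close> will do.\<close>

lemma schur_prime_exists:
  fixes n k :: nat
  assumes n: "n > 0" and not_pow3: "\<And>u. u \<ge> 2 \<Longrightarrow> 2 * n + 1 \<noteq> 3 ^ u" and k: "1 \<le> k" "k \<le> n"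
  shows "\<exists>p t. prime p \<and> k + 2 \<le> p \<and> p dvd 2 * t + 1 \<and> t \<le> n \<and> 2 * n < 2 * t + k"
proof (cases "k = 1")
  case True
  obtain p where p: "prime p" "p dvd 2 * n + 1" using prime_factor_nat[of "2 * n + 1"] n by auto
  have "p \<noteq> 2" using p(2) by (auto simp: dvd_add_right_iff)
  then have "3 \<le> p" using prime_ge_2_nat[OF p(1)] by simp
  then show ?thesis using p True by (intro exI[of _ p] exI[of _ n]) auto
next
  case False
  define l where "l = k div 2"
  have l: "l \<ge> 1" "2 * l \<le> k" "k \<le> 2 * l + 1" using False k by (auto simp: l_def)
  define M where "M = 2 * n + 3 - 2 * l"
  have M: "odd M" "2 * l + 3 \<le> M" "M + 2 * (l - 1) = 2 * n + 1" using l k by (auto simp: M_def)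
  have "2 * n + 1 \<noteq> 3 ^ u" for u
  proof (cases "u \<ge> 2")
    case False
    then have "u = 0 \<or> u = 1" by arith
    then show ?thesis using l k by auto
  qed (rule not_pow3)
  then obtain i p where ip: "i < l" "prime p" "2 * l + 3 \<le> p" "p dvd M + 2 * i"
    using schur_odd_run[OF M(1,2) l(1)] M(3) by metis
  have "M + 2 * i = 2 * (n + 1 - l + i) + 1" using l k by (simp add: M_def)
  then show ?thesis using ip l k by (intro exI[of _ p] exI[of _ "n + 1 - l + i"]) auto
qed

section \<open>Irreducibility\<close>

lemma prime_dvd_odd_numbers:
  assumes "p dvd 2 * t + 1" "t \<le> n" "j < t"
  shows "p dvd oddquot n j"
proof -
  have "2 * t + 1 dvd oddquot n j" unfolding oddquot_def using assms by (intro dvd_prodI) auto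
  then show ?thesis using assms(1) dvd_trans by blast
qed

lemma smult_const_dvd: "p dvd c \<Longrightarrow> [:p:] dvd smult c f" for p c :: int
  by (auto simp: const_poly_dvd_iff)

locale schur_poly =
  fixes n :: nat and \<phi> :: "int poly" and an :: int and a :: "nat \<Rightarrow> int poly"
  assumes n_pos: "n > 0"
    and not_pow3: "\<And>u::nat. u \<ge> 2 \<Longrightarrow> 2 * n + 1 \<noteq> 3 ^ u"
    and monic: "lead_coeff \<phi> = 1"
    and irr_mod: "\<And>p::int. prime p \<Longrightarrow> p < 2 * int n + 2 \<Longrightarrow> irreducible_mod p \<phi>"
    and deg_a: "\<And>i. i < n \<Longrightarrow> degree (a i) < degree \<phi>"
    and content_cond: "\<And>p::int. prime p \<Longrightarrow> p < 2 * int n + 2 \<Longrightarrow> \<not> p dvd content (smult an (a 0))"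
begin

text \<open>u_(2n+2) times the polynomial of the theorem; \<open>oddquot n j\<close> is
  u_(2n+2)/u_(2j+2).\<close>

definition F :: "int poly" where
  "F = smult an (\<phi> ^ (2 * n)) + (\<Sum>j<n. smult (int (oddquot n j)) (a j) * \<phi> ^ (2 * j))"

lemma adic: "prime p \<Longrightarrow> p < 2 * int n + 2 \<Longrightarrow> adic p \<phi>"
  using adic_if_irreducible_mod monic irr_mod by blast

lemma deg_phi: "degree \<phi> > 0"
  using adic[of 2] n_pos by (auto simp: adic_def)

lemmas phi_power = monic_power_degree[OF monic]

lemma not_dvd_an: "prime p \<Longrightarrow> p < 2 * int n + 2 \<Longrightarrow> \<not> p dvd an"
  using content_cond[of p] by auto

lemma an_nonzero: "an \<noteq> 0"
  using not_dvd_an[of 2] n_pos by auto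

lemma F_top: "degree F = 2 * n * degree \<phi>" "lead_coeff F = an"
proof -
  define A S where "A = smult an (\<phi> ^ (2 * n))"
    and "S = (\<Sum>j<n. smult (int (oddquot n j)) (a j) * \<phi> ^ (2 * j))"
  have S: "degree S < 2 * n * degree \<phi>"
    unfolding S_def
  proof (rule degree_sum_less)
    fix j assume "j \<in> {..<n}"
    then have j: "j < n" by simp
    have "degree (smult (int (oddquot n j)) (a j) * \<phi> ^ (2 * j)) \<le> degree (a j) + 2 * j * degree \<phi>"
      using degree_mult_le[of "smult (int (oddquot n j)) (a j)" "\<phi> ^ (2 * j)"]
        degree_smult_le[of "int (oddquot n j)" "a j"] phi_power(2)[of "2 * j"] by linarith
    also have "\<dots> < (1 + 2 * j) * degree \<phi>" using deg_a[OF j] by simp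
    also have "\<dots> \<le> 2 * n * degree \<phi>" using j by (intro mult_le_mono1) simp
    finally show "degree (smult (int (oddquot n j)) (a j) * \<phi> ^ (2 * j)) < 2 * n * degree \<phi>" .
  qed (use n_pos deg_phi in simp)
  have A: "degree A = 2 * n * degree \<phi>" using an_nonzero phi_power(2) by (simp add: A_def)
  have F: "F = A + S" by (simp add: F_def A_def S_def)
  show deg: "degree F = 2 * n * degree \<phi>" unfolding F using S A by (simp add: degree_add_eq_left)
  have "coeff S (2 * n * degree \<phi>) = 0" using S by (rule coeff_eq_0)
  moreover have "coeff A (2 * n * degree \<phi>) = an"
    using phi_power(1)[of "2 * n"] unfolding phi_power(2) by (simp add: A_def)
  ultimately show "lead_coeff F = an" unfolding deg by (simp add: F)
qed

text \<open>For \<open>j < t\<close> the factor \<open>2 * t + 1\<close> survives in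
  \<open>oddquot n j\<close>, so the terms below \<open>\<phi> ^ (2 * t)\<close> vanish modulo
  \<open>p\<close>.\<close>

lemma power_cong_dvd_F:
  assumes p: "p dvd 2 * t + 1" and t: "t \<le> n"
  shows "cong_dvd (int p) (\<phi> ^ (2 * t)) F"
proof -
  define X where "X = smult an (\<phi> ^ (2 * n - 2 * t)) + (\<Sum>j\<in>{t..<n}. smult (int (oddquot n j)) (a j) * \<phi> ^ (2 * j - 2 * t))"
  have pow: "\<phi> ^ (2 * t) * \<phi> ^ (2 * j - 2 * t) = \<phi> ^ (2 * j)" if "t \<le> j" for j
    using that by (simp flip: power_add)
  have "\<phi> ^ (2 * t) * X = smult an (\<phi> ^ (2 * n)) + (\<Sum>j\<in>{t..<n}. smult (int (oddquot n j)) (a j) * \<phi> ^ (2 * j))"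
  proof -
    have "\<phi> ^ (2 * t) * smult an (\<phi> ^ (2 * n - 2 * t)) = smult an (\<phi> ^ (2 * n))"
      using pow[OF t] by simp
    moreover have "\<phi> ^ (2 * t) * (smult (int (oddquot n j)) (a j) * \<phi> ^ (2 * j - 2 * t))
        = smult (int (oddquot n j)) (a j) * \<phi> ^ (2 * j)" if "t \<le> j" for j
      using pow[OF that] by (simp add: mult.left_commute)
    ultimately show ?thesis
      unfolding X_def distrib_left sum_distrib_left by (metis (no_types, lifting) atLeastLessThan_iff sum.cong)
  qed
  moreover have split: "{..<n} = {..<t} \<union> {t..<n}" using t by auto
  have "(\<Sum>j<n. smult (int (oddquot n j)) (a j) * \<phi> ^ (2 * j))
     = (\<Sum>j<t. smult (int (oddquot n j)) (a j) * \<phi> ^ (2 * j)) + (\<Sum>j\<in>{t..<n}. smult (int (oddquot n j)) (a j) * \<phi> ^ (2 * j))"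
    unfolding split by (rule sum.union_disjoint) auto
  ultimately have "F - \<phi> ^ (2 * t) * X = (\<Sum>j<t. smult (int (oddquot n j)) (a j) * \<phi> ^ (2 * j))"
    unfolding F_def by simp
  also have "[:int p:] dvd \<dots>"
    using prime_dvd_odd_numbers[OF p t] by (intro dvd_sum dvd_mult2 smult_const_dvd) simp
  finally show ?thesis unfolding cong_dvd_def by blast
qed

text \<open>Modulo a prime factor of \<open>2 * n + 1\<close>, \<open>F\<close> is a constant times
  \<open>\<phi> ^ (2 * n)\<close>, so powers of \<open>\<phi>\<close> divide \<open>G\<close> and
  \<open>H\<close>; the degrees add up with no room left.\<close>

lemma factor_degrees:
  assumes "F = G * H"
  obtains k l where "k + l = 2 * n" "degree G = k * degree \<phi>" "degree H = l * degree \<phi>"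
proof -
  obtain p where pr: "prime p" "p dvd 2 * n + 1" using prime_factor_nat[of "2 * n + 1"] n_pos by auto
  have lt: "int p < 2 * int n + 2" using dvd_imp_le[OF pr(2)] by simp
  interpret adic "int p" \<phi> using pr lt by (intro adic) simp_all
  obtain k l where kl: "k + l = 2 * n" "cong_dvd (int p) (\<phi> ^ k) G" "cong_dvd (int p) (\<phi> ^ l) H"
    using cong_dvd_power_mult[of "2 * n" G H] power_cong_dvd_F[OF pr(2)] assms by auto
  have "lead_coeff G * lead_coeff H = an" using F_top(2) assms by (simp add: lead_coeff_mult)
  then have nd: "\<not> int p dvd lead_coeff G" "\<not> int p dvd lead_coeff H"
    using not_dvd_an[of "int p"] pr(1) lt by auto
  have le: "k * degree \<phi> \<le> degree G" "l * degree \<phi> \<le> degree H"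
    using cong_dvd_degree[OF phi_power(1) kl(2) nd(1)] cong_dvd_degree[OF phi_power(1) kl(3) nd(2)] phi_power(2)
    by simp_all
  have "F \<noteq> 0" using F_top(2) an_nonzero by auto
  then have "degree G + degree H = degree F" unfolding assms by (subst degree_mult_eq) auto
  then have "degree G + degree H = k * degree \<phi> + l * degree \<phi>"
    using F_top(1) by (simp add: kl(1) flip: distrib_right)
  then show ?thesis using le that[OF kl(1)] by simp
qed

lemma no_small_factor:
  assumes F: "F = G * H" and kl: "k + l = 2 * n" "degree G = k * degree \<phi>" "degree H = l * degree \<phi>"
    and k: "1 \<le> k" "k \<le> n"
  shows False
proof -
  obtain p t where pr: "prime p" "k + 2 \<le> p" and t: "p dvd 2 * t + 1" "t \<le> n" "2 * n < 2 * t + k"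
    using schur_prime_exists[OF n_pos not_pow3 k] by blast
  have odd: "odd p" using t(1) by (metis dvd_trans odd_two_times_div_two_succ even_add even_mult_iff odd_one even_numeral)
  have lt: "int p < 2 * int n + 2" using dvd_imp_le[OF t(1)] t(2) by simp
  interpret adic "int p" \<phi> using pr lt by (intro adic) simp_all
  have "lead_coeff G * lead_coeff H = an" using F_top(2) F by (simp add: lead_coeff_mult)
  then have nd: "\<not> int p dvd lead_coeff G" "\<not> int p dvd lead_coeff H"
    using not_dvd_an[of "int p"] pr(1) lt by auto
  define V where "V = multiplicity p (oddprod n)"
  \<comment> \<open>The expansions of \<open>G\<close> and \<open>H\<close> have
    \<open>2 * n + 2\<close> terms together; odd positions, including the last, hold 0.\<close>
  define c where "c s = (if s = 2 * n then [:an:] else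
    if even s \<and> s < 2 * n then smult (int (oddquot n (s div 2))) (a (s div 2)) else 0)" for s
  have deg_c: "degree (c s) < degree \<phi>" for s
    using deg_phi deg_a[of "s div 2"] degree_smult_le[of "int (oddquot n (s div 2))" "a (s div 2)"]
    by (auto simp: c_def)
  have "Suc k + Suc l = 2 * Suc n" using kl(1) by simp
  then have "(\<Sum>s<Suc k + Suc l. c s * \<phi> ^ s) = (\<Sum>j<Suc n. c (2 * j) * \<phi> ^ (2 * j) + c (2 * j + 1) * \<phi> ^ (2 * j + 1))"
    by (simp only: sum_even_odd)
  also have "\<dots> = F"
    by (auto simp: c_def F_def intro!: sum.cong)
  finally have eq: "G * H = (\<Sum>s<Suc k + Suc l. c s * \<phi> ^ s)" using F by simp
  \<comment> \<open>What \<open>oddquot n j\<close> lacks of the \<open>V\<close> powers of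
    \<open>p\<close> is the multiplicity in \<open>oddprod j\<close>, and its weight is repaid by
    the exponent \<open>2 * j\<close> of \<open>\<phi>\<close>.\<close>
  have heavy_c: "heavy (p - 1) ((p - 1) * V) s (c s)" for s
  proof -
    consider "s = 2 * n" | j where "s = 2 * j" "j < n" | "c s = 0"
      by (cases "s = 2 * n"; cases "even s \<and> s < 2 * n") (auto simp: c_def elim!: evenE)
    then show ?thesis
    proof cases
      case 1
      then show ?thesis using multiplicity_oddprod_le[OF pr(1) odd, of n]
        unfolding heavy_def V_def by (intro exI[of _ 0]) simp
    next
      case 2
      define e where "e = multiplicity p (oddquot n j)"
      have q: "oddprod n = oddprod j * oddquot n j" using oddprod_quot[of j n] 2 by simp
      have "V = multiplicity p (oddprod j) + e"
        unfolding V_def q e_def using pr(1) oddprod_pos[of n] unfolding q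
        by (intro prime_elem_multiplicity_mult_distrib) auto
      then have "(p - 1) * V \<le> (p - 1) * e + s"
        using multiplicity_oddprod_le[OF pr(1) odd, of j] 2 by (simp add: distrib_left)
      moreover have "p ^ e dvd oddquot n j" unfolding e_def by (rule multiplicity_dvd)
      then have "int p ^ e dvd int (oddquot n j)" by (metis int_dvd_int_iff semiring_1_class.of_nat_power)
      then have "[:int p:] ^ e dvd c s"
        using 2 unfolding poly_const_pow c_def by (auto intro: smult_const_dvd)
      ultimately show ?thesis unfolding heavy_def by blast
    next
      case 3
      then show ?thesis using heavy_0[of "p - 1"] pr(2) by simp
    qed
  qed
  \<comment> \<open>Condition (ii) enters here: some coefficient of \<open>a 0\<close> is prime to
    \<open>p\<close>, so \<open>c 0\<close> contains only the \<open>V\<close> powers of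
    \<open>p\<close> from \<open>oddprod n\<close>.\<close>
  have "\<not> heavy (p - 1) (Suc ((p - 1) * V)) 0 (c 0)"
  proof
    assume "heavy (p - 1) (Suc ((p - 1) * V)) 0 (c 0)"
    then obtain e where e: "Suc ((p - 1) * V) \<le> (p - 1) * e" "[:int p:] ^ e dvd c 0" by (auto simp: heavy_def)
    have "(p - 1) * V < (p - 1) * e" using e(1) by (rule Suc_le_lessD)
    then have "Suc V \<le> e" by simp
    then have "[:int p:] ^ Suc V dvd c 0" using e(2) power_le_dvd by blast
    moreover have "c 0 = smult (int (oddprod n)) (a 0)"
      using oddprod_quot[of 0 n] n_pos by (simp add: c_def oddprod_def)
    ultimately have dvd: "int p ^ Suc V dvd int (oddprod n) * coeff (a 0) i" for i
      unfolding poly_const_pow const_poly_dvd_iff by simp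
    obtain B where B: "oddprod n = p ^ V * B" "\<not> p dvd B"
      using multiplicity_decompose'[of "oddprod n" p] oddprod_pos[of n] pr(1) unfolding V_def
      by (metis not_prime_unit not_gr_zero)
    have "int p dvd coeff (a 0) i" for i
    proof -
      have "int p ^ V * int p dvd int p ^ V * (int B * coeff (a 0) i)"
        using dvd[of i] unfolding B(1) power_Suc2 by (simp add: mult.assoc)
      then have "int p dvd int B * coeff (a 0) i" using pr(1) by (auto simp: dvd_mult_cancel_left)
      then show ?thesis using pr(1) B(2) by (simp add: prime_dvd_mult_iff)
    qed
    then have "int p dvd content (smult an (a 0))"
      using const_poly_dvd_iff_dvd_content[of "int p" "smult an (a 0)"] by (simp add: const_poly_dvd_iff)
    then show False using content_cond[of "int p"] pr(1) lt by simp
  qed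
  then have not_G: "\<not> cong_dvd (int p) \<phi> G"
    using factor_not_cong_dvd[OF _ eq deg_c kl(2) nd(1) kl(3) nd(2) heavy_c] pr(2) by simp
  obtain i j where ij: "i + j = 2 * t" "cong_dvd (int p) (\<phi> ^ i) G" "cong_dvd (int p) (\<phi> ^ j) H"
    using cong_dvd_power_mult[of "2 * t" G H] power_cong_dvd_F[OF t(1,2)] F by auto
  have "i = 0"
  proof (rule ccontr)
    assume "i \<noteq> 0"
    then have "\<phi> ^ i = \<phi> * \<phi> ^ (i - 1)" by (cases i) auto
    then show False using ij(2) not_G unfolding cong_dvd_def by (metis mult.assoc)
  qed
  \<comment> \<open>All of \<open>\<phi> ^ (2 * t)\<close> must go into \<open>H\<close>, which has
    room for only \<open>l = 2 * n - k < 2 * t\<close> factors.\<close>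
  then have "2 * t * degree \<phi> \<le> l * degree \<phi>"
    using cong_dvd_degree[OF phi_power(1) ij(3) nd(2)] ij(1) kl(3) phi_power(2) by simp
  then have "2 * t \<le> l" using deg_phi by simp
  then show False using kl(1) t(3) by simp
qed

lemma no_factor:
  assumes "F = G * H"
  shows "degree G = 0 \<or> degree H = 0"
proof (rule ccontr)
  assume nz: "\<not> (degree G = 0 \<or> degree H = 0)"
  obtain k l where kl: "k + l = 2 * n" "degree G = k * degree \<phi>" "degree H = l * degree \<phi>"
    using factor_degrees[OF assms] .
  have "k \<ge> 1" "l \<ge> 1" using kl nz by (auto simp: Suc_le_eq intro: gr0I)
  show False
  proof (cases "k \<le> n")
    case True
    then show False using no_small_factor[OF assms kl \<open>k \<ge> 1\<close>] by simp
  next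
    case False
    have "F = H * G" "l + k = 2 * n" using assms kl(1) by (simp_all add: mult.commute)
    then show False using no_small_factor[of H G l k] kl(2,3) \<open>l \<ge> 1\<close> False by simp
  qed
qed

end

text \<open>Gauss's lemma, as \<open>rat_to_int_factor\<close>, makes a rational factorization
  integral without changing degrees. The hypothesis speaks of degrees because integer constants need
  not be units.\<close>

lemma irreducible_smult_of_int:
  fixes F :: "int poly" and c :: rat
  assumes "c \<noteq> 0" "degree F > 0" "\<And>G H. F = G * H \<Longrightarrow> degree G = 0 \<or> degree H = 0"
  shows "irreducible (smult c (map_poly of_int F))"
proof (rule irreducibleI)
  have F0: "map_poly rat_of_int F \<noteq> 0" using assms(2) by auto
  then show "smult c (map_poly rat_of_int F) \<noteq> 0" using assms(1) by simp
  show "\<not> is_unit (smult c (map_poly rat_of_int F))"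
    using assms(1,2) by (simp add: is_unit_iff_degree F0)
  fix x y assume xy: "smult c (map_poly rat_of_int F) = x * y"
  have "map_poly rat_of_int F = smult (1 / c) (smult c (map_poly rat_of_int F))" using assms(1) by simp
  also have "\<dots> = smult (1 / c) x * y" by (simp add: xy)
  finally obtain G H where GH: "F = G * H" "degree G = degree (smult (1 / c) x)" "degree H = degree y"
    using rat_to_int_factor by metis
  have "x \<noteq> 0" "y \<noteq> 0" using xy F0 assms(1) by auto
  then show "is_unit x \<or> is_unit y"
    using assms(3)[OF GH(1)] GH(2,3) assms(1) by (simp add: is_unit_iff_degree)
qed

theorem theorem1p4:
  fixes n :: nat and \<phi> :: "int poly" and an :: int and a :: "nat \<Rightarrow> int poly"
  assumes n_pos: "n > 0"
    and not_pow3: "\<And>u::nat. u \<ge> 2 \<Longrightarrow> 2 * n + 1 \<noteq> 3 ^ u"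
    and monic: "lead_coeff \<phi> = 1"
    and irr_mod: "\<And>p::int. prime p \<Longrightarrow> p < 2 * int n + 2 \<Longrightarrow> irreducible_mod p \<phi>"
    and deg_a: "\<And>i. i < n \<Longrightarrow> degree (a i) < degree \<phi>"
    and content_cond: "\<And>p::int. prime p \<Longrightarrow> p < 2 * int n + 2 \<Longrightarrow> \<not> p dvd content (smult an (a 0))"
  shows "irreducible
    (smult (of_int an / of_nat (oddfact (2 * n + 2))) ((map_poly of_int \<phi> :: rat poly) ^ (2 * n))
     + (\<Sum>j<n. map_poly of_int (a j) * smult (1 / of_nat (oddfact (2 * j + 2))) ((map_poly of_int \<phi>) ^ (2 * j))))"
proof -
  interpret schur_poly n \<phi> an a by unfold_locales (fact assms)+
  define u where "u = rat_of_nat (oddprod n)"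
  have u: "u \<noteq> 0" using oddprod_pos[of n] by (simp add: u_def)
  have "smult (1 / u) (map_poly of_int F)
      = smult (of_int an / of_nat (oddfact (2 * n + 2))) ((map_poly of_int \<phi> :: rat poly) ^ (2 * n))
     + (\<Sum>j<n. map_poly of_int (a j) * smult (1 / of_nat (oddfact (2 * j + 2))) ((map_poly of_int \<phi>) ^ (2 * j)))"
  proof -
    have "of_nat (oddquot n j) / u = 1 / rat_of_nat (oddprod j)" if "j < n" for j
      using oddprod_quot[of j n] that oddprod_pos[of n] by (simp add: u_def)
    then show ?thesis
      unfolding F_def oddfact_eq u_def[symmetric]
      by (auto simp: hom_distribs smult_add_right smult_sum2 intro!: sum.cong)
  qed
  moreover have "irreducible (smult (1 / u) (map_poly rat_of_int F))"
    using u F_top(1) n_pos deg_phi no_factor by (intro irreducible_smult_of_int) auto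
  ultimately show ?thesis by simp
qed

end
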